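(* Let $E$ and $F$ be two rank-one JB$^*$-triples, and let $\Phi : \mathcal{U}_{min}(E) \to \mathcal{U}_{min}(F)$ be a transformation (not assumed injective or surjective) preserving triple transition pseudo-probabilities, that is, $$TTP(\Phi(u),\Phi(e))= \varphi_{\Phi(e)} (\Phi(u)) = \varphi_{e} (u) = TTP(u,e) \quad\text{for all } e,u\in \mathcal{U}_{min} (E).$$ Then $\Phi$ extends to a complex-linear isometric triple homomorphism from $E$ to $F$.
   Context: A JB$^*$-triple is a complex Banach space $E$ with a continuous triple product $\{\cdot,\cdot,\cdot\}:E\times E\times E\to E$, symmetric and bilinear in the first and third variables and conjugate-linear in the middle one, such that, writing $L(a,b)x=\{a,b,x\}$: (a) $L(a,b) L(x,y) = L(x,y) L(a,b) + L(L(a,b)x,y) - L(x,L(b,a)y)$ for all $a,b,x,y\in E$; (b) each $L(a,a)$ is a hermitian operator with non-negative spectrum; (c) $\|\{a,a,a\}\|=\|a\|^3$ for all $a\in E$. A JBW$^*$-triple is a JB$^*$-triple which is a dual Banach space; it has a unique isometric predual, denoted $E_*$. A triple homomorphism is a linear map $T$ with $T\{a,b,c\}=\{T(a),T(b),T(c)\}$ for all $a,b,c$. Elements $a,b\in E$ are orthogonal if $L(a,b)=0$. A subset $S\subseteq E$ is orthogonal if $0\notin S$ and distinct elements of $S$ are orthogonal. The rank of $E$ is the minimal cardinal number $r$ with $\mathrm{card}(S)\leq r$ for every orthogonal subset $S\subseteq E$. A rank-one JB$^*$-triple is reflexive, hence a JBW$^*$-triple, and it is isometrically isomorphic to a complex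 Hilbert space. A tripotent is an element $e$ with $\{e,e,e\}=e$. For a tripotent $e$, $E=E_0(e)\oplus E_1(e)\oplus E_2(e)$ where $E_k(e)=\{x\in E: L(e,e)x=\frac{k}{2}x\}$; the corresponding projection onto $E_k(e)$ is denoted $P_k(e)$. A tripotent $e$ is minimal if $E_2(e)=\mathbb{C}e\neq\{0\}$. $\mathcal{U}_{min}(E)$ denotes the set of minimal tripotents of $E$. For each minimal tripotent $e$ in a JBW$^*$-triple $E$ there is a unique extreme point $\varphi_e$ of the closed unit ball of $E_*$ with $P_2(e)(x)=\varphi_e(x)e$ for all $x\in E$. For minimal tripotents $e,v$ in $E$, the triple transition pseudo-probability from $e$ to $v$ is the complex number $TTP(e,v)=\varphi_v(e)$. *)

theory Defs
  imports "HOL-Analysis.Analysis"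
begin

section \<open>Complex Banach spaces and their operators\<close>

class complex_banach = banach +
  fixes scaleC :: "complex \<Rightarrow> 'a \<Rightarrow> 'a" (infixr "*\<^sub>C" 75)
  assumes scaleC_add_right: "c *\<^sub>C (x + y) = c *\<^sub>C x + c *\<^sub>C y"
    and scaleC_add_left: "(c + d) *\<^sub>C x = c *\<^sub>C x + d *\<^sub>C x"
    and scaleC_scaleC: "c *\<^sub>C d *\<^sub>C x = (c * d) *\<^sub>C x"
    and scaleC_of_real: "complex_of_real r *\<^sub>C x = r *\<^sub>R x"
    and norm_scaleC: "norm (c *\<^sub>C x) = cmod c * norm x"

definition clinear :: "('a::complex_banach \<Rightarrow> 'b::complex_banach) \<Rightarrow> bool" where
  "clinear T \<longleftrightarrow> (\<forall>x y. T (x + y) = T x + T y) \<and> (\<forall>c x. T (c *\<^sub>C x) = c *\<^sub>C T x)"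

definition bounded_clinear :: "('a::complex_banach \<Rightarrow> 'b::complex_banach) \<Rightarrow> bool" where
  "bounded_clinear T \<longleftrightarrow> clinear T \<and> (\<exists>K. \<forall>x. norm (T x) \<le> K * norm x)"

definition op_spectrum :: "('a::complex_banach \<Rightarrow> 'a) \<Rightarrow> complex set" where
  "op_spectrum T = {z. \<not> (\<exists>S. bounded_clinear S \<and>
     (\<forall>x. S (T x - z *\<^sub>C x) = x) \<and> (\<forall>x. T (S x) - z *\<^sub>C S x = x))}"

definition op_exp :: "complex \<Rightarrow> ('a::complex_banach \<Rightarrow> 'a) \<Rightarrow> 'a \<Rightarrow> 'a" where
  "op_exp z T x = (\<Sum>n. (z ^ n / fact n) *\<^sub>C (T ^^ n) x)"

text \<open>Since \<open>exp (- i t T)\<close> is the inverse of \<open>exp (i t T)\<close>, it is the same to ask that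
  \<open>exp (i t T)\<close> be isometric for all real \<open>t\<close> or (on a nonzero space) that it have norm 1
  for all real \<open>t\<close>.\<close>

definition hermitian_op :: "('a::complex_banach \<Rightarrow> 'a) \<Rightarrow> bool" where
  "hermitian_op T \<longleftrightarrow> bounded_clinear T \<and>
     (\<forall>(t::real) x. norm (op_exp (\<i> * of_real t) T x) = norm x)"


section \<open>JB*-triples\<close>

type_synonym 'a tprod = "'a \<Rightarrow> 'a \<Rightarrow> 'a \<Rightarrow> 'a"

definition L_op :: "'a tprod \<Rightarrow> 'a \<Rightarrow> 'a \<Rightarrow> 'a \<Rightarrow> 'a" where
  "L_op tp a b = (\<lambda>x. tp a b x)"

locale jbstar_triple =
  fixes tp :: "'a::complex_banach tprod"
  assumes tp_continuous: "continuous_on UNIV (\<lambda>(a, b, c). tp a b c)"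
    and tp_sym: "tp a b c = tp c b a"
    and tp_add_left: "tp (a + a') b c = tp a b c + tp a' b c"
    and tp_scaleC_left: "tp (s *\<^sub>C a) b c = s *\<^sub>C tp a b c"
    and tp_add_mid: "tp a (b + b') c = tp a b c + tp a b' c"
    and tp_scaleC_mid: "tp a (s *\<^sub>C b) c = cnj s *\<^sub>C tp a b c"
    and jordan_identity:
      "L_op tp a b (L_op tp x y z) = L_op tp x y (L_op tp a b z)
         + L_op tp (L_op tp a b x) y z - L_op tp x (L_op tp b a y) z"
    and L_op_hermitian: "hermitian_op (L_op tp a a)"
    and L_op_nonneg_spectrum: "op_spectrum (L_op tp a a) \<subseteq> \<real>\<^sub>\<ge>\<^sub>0"
    and norm_tp_cube: "norm (tp a a a) = norm a ^ 3"

definition triple_homomorphism ::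
    "'a::complex_banach tprod \<Rightarrow> 'b::complex_banach tprod \<Rightarrow> ('a \<Rightarrow> 'b) \<Rightarrow> bool" where
  "triple_homomorphism tpE tpF T \<longleftrightarrow>
     clinear T \<and> (\<forall>a b c. T (tpE a b c) = tpF (T a) (T b) (T c))"

definition triple_orthogonal :: "'a::complex_banach tprod \<Rightarrow> 'a \<Rightarrow> 'a \<Rightarrow> bool" where
  "triple_orthogonal tp a b \<longleftrightarrow> L_op tp a b = (\<lambda>x. 0)"

definition orthogonal_subset :: "'a::complex_banach tprod \<Rightarrow> 'a set \<Rightarrow> bool" where
  "orthogonal_subset tp S \<longleftrightarrow>
     0 \<notin> S \<and> (\<forall>a\<in>S. \<forall>b\<in>S. a \<noteq> b \<longrightarrow> triple_orthogonal tp a b)"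


subsection \<open>Rank\<close>

context includes cardinal_syntax
begin

definition bounds_orthogonal :: "'a::complex_banach tprod \<Rightarrow> 'r rel \<Rightarrow> bool" where
  "bounds_orthogonal tp r \<longleftrightarrow>
     Card_order r \<and> (\<forall>S. orthogonal_subset tp S \<longrightarrow> |S| \<le>o r)"

text \<open>\<open>has_rank tp r\<close>: the cardinal \<open>r\<close> is, up to \<open>=o\<close>, the rank of the triple.
  Competing cardinals \<open>r'\<close> need only be taken on the type \<open>'a\<close>: the cardinality of \<open>'a\<close> is
  itself a bound, and every smaller cardinal is the cardinality of a subset of \<open>'a\<close>.\<close>

definition has_rank :: "'a::complex_banach tprod \<Rightarrow> 'r rel \<Rightarrow> bool" where
  "has_rank tp r \<longleftrightarrow>
     bounds_orthogonal tp r \<and> (\<forall>r' :: 'a rel. bounds_orthogonal tp r' \<longrightarrow> r \<le>o r')"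

end

definition rank_one :: "'a::complex_banach tprod \<Rightarrow> bool" where
  "rank_one tp \<longleftrightarrow> has_rank tp BNF_Cardinal_Arithmetic.cone"


subsection \<open>Tripotents and Peirce decomposition\<close>

definition tripotent :: "'a::complex_banach tprod \<Rightarrow> 'a \<Rightarrow> bool" where
  "tripotent tp e \<longleftrightarrow> tp e e e = e"

definition peirce_space :: "'a::complex_banach tprod \<Rightarrow> nat \<Rightarrow> 'a \<Rightarrow> 'a set" where
  "peirce_space tp k e = {x. L_op tp e e x = (of_nat k / 2) *\<^sub>C x}"

text \<open>The component in \<open>E\<^sub>k(e)\<close> (for \<open>k \<le> 2\<close>) of the decomposition
  \<open>x \<in> E\<^sub>0(e) \<oplus> E\<^sub>1(e) \<oplus> E\<^sub>2(e)\<close>.\<close>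

definition peirce_proj :: "'a::complex_banach tprod \<Rightarrow> nat \<Rightarrow> 'a \<Rightarrow> 'a \<Rightarrow> 'a" where
  "peirce_proj tp k e x = (THE y. y \<in> peirce_space tp k e \<and>
     (\<exists>f. (\<forall>j\<in>{0..2} - {k}. f j \<in> peirce_space tp j e) \<and> x = y + (\<Sum>j\<in>{0..2} - {k}. f j)))"

definition minimal_tripotents :: "'a::complex_banach tprod \<Rightarrow> 'a set" where
  "minimal_tripotents tp = {e. tripotent tp e \<and>
     peirce_space tp 2 e = range (\<lambda>z. z *\<^sub>C e) \<and> range (\<lambda>z. z *\<^sub>C e) \<noteq> {0}}"


subsection \<open>Predual and transition pseudo-probabilities\<close>

definition cdual :: "('a::complex_banach \<Rightarrow>\<^sub>L complex) set" where
  "cdual = {f. \<forall>c x. blinfun_apply f (c *\<^sub>C x) = c * blinfun_apply f x}"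

text \<open>A predual is realised inside the dual: it is a norm-closed complex subspace \<open>V\<close> of the dual
  for which evaluation is an isometry of the whole space onto the dual of \<open>V\<close>; \<open>g\<close> below ranges over
  the bounded complex-linear functionals on \<open>V\<close>, and \<open>blinfun_mult_right c o\<^sub>L f\<close> is the functional
  \<open>c f\<close>.\<close>

definition is_predual :: "('a::complex_banach \<Rightarrow>\<^sub>L complex) set \<Rightarrow> bool" where
  "is_predual V \<longleftrightarrow>
     V \<subseteq> cdual \<and> closed V \<and> 0 \<in> V \<and> (\<forall>f\<in>V. \<forall>g\<in>V. f + g \<in> V) \<and>
     (\<forall>c. \<forall>f\<in>V. blinfun_mult_right c o\<^sub>L f \<in> V) \<and>
     (\<forall>x. (SUP f\<in>{f \<in> V. norm f \<le> 1}. cmod (blinfun_apply f x)) = norm x) \<and>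
     (\<forall>g. (\<forall>f\<in>V. \<forall>h\<in>V. g (f + h) = g f + g h) \<and>
          (\<forall>c. \<forall>f\<in>V. g (blinfun_mult_right c o\<^sub>L f) = c * g f) \<and>
          (\<exists>K. \<forall>f\<in>V. cmod (g f) \<le> K * norm f)
       \<longrightarrow> (\<exists>x. \<forall>f\<in>V. g f = blinfun_apply f x))"

text \<open>On a dual space without a unique predual, or on a space that is not a dual space, \<open>predual\<close>
  is unspecified; a JBW*-triple has exactly one predual in this sense.\<close>

definition predual :: "('a::complex_banach \<Rightarrow>\<^sub>L complex) set" where
  "predual = (THE V. is_predual V)"

definition phi :: "'a::complex_banach tprod \<Rightarrow> 'a \<Rightarrow> ('a \<Rightarrow>\<^sub>L complex)" where
  "phi tp e = (THE \<phi>. \<phi> extreme_point_of {f \<in> predual. norm f \<le> 1} \<and>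
     (\<forall>x. peirce_proj tp 2 e x = blinfun_apply \<phi> x *\<^sub>C e))"

definition TTP :: "'a::complex_banach tprod \<Rightarrow> 'a \<Rightarrow> 'a \<Rightarrow> complex" where
  "TTP tp e v = blinfun_apply (phi tp v) e"

end

theory Submission
  imports Defs
begin

text \<open>Let \<open>a \<in> E\<close> and \<open>T = L(a, a)\<close>. On the closed span of the powers of \<open>a\<close> one has
  \<open>L(T b, c) = L(b, T c)\<close>, so for real functions \<open>f, g\<close> with \<open>f g = 0\<close> the elements \<open>f(T) a\<close> and
  \<open>g(T) a\<close> are orthogonal. Since \<open>T\<close> is hermitian, \<open>cos (s T - \<theta>)\<close> is a contraction, hence
  \<open>\<bar>sin (s T - \<theta>)\<bar> = sqrt (1 - cos\<^sup>2 (s T - \<theta>))\<close> is given by a convergent binomial series, and in rank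
  one \<open>\<bar>sin\<bar> a = \<plusminus> sin a\<close>. The sign flips when \<open>\<theta>\<close> moves by \<open>\<pi>\<close>, so by connectedness
  \<open>sin (s T - \<theta>) a = 0\<close> for some \<open>\<theta>\<close>. Thus \<open>a\<close> is an eigenvector of every \<open>exp (i s T)\<close>, so of \<open>T\<close>,
  and \<open>{a, a, a} = \<bar>a\<bar>\<^sup>2 a\<close>. Polarizing this identity shows that the norm comes from an inner product
  with \<open>{x, y, z} = (\<langle>x, y\<rangle> z + \<langle>z, y\<rangle> x) / 2\<close>. The minimal tripotents are then the unit vectors,
  \<open>\<phi>\<^sub>e = \<langle>\<cdot>, e\<rangle>\<close>, and a map between unit spheres that preserves inner products extends to a
  linear isometry.\<close>

section \<open>Operators on complex Banach spaces\<close>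

lemma bounded_bilinear_scaleC:
  "bounded_bilinear (scaleC :: complex \<Rightarrow> 'a::complex_banach \<Rightarrow> 'a)"
proof
  show "(r *\<^sub>R c) *\<^sub>C x = r *\<^sub>R (c *\<^sub>C x)" for r and c :: complex and x :: 'a
    by (simp add: scaleC_of_real[symmetric] scaleC_scaleC scaleR_conv_of_real)
  show "c *\<^sub>C (r *\<^sub>R x) = r *\<^sub>R (c *\<^sub>C x)" for r and c :: complex and x :: 'a
    by (simp add: scaleC_of_real[symmetric] scaleC_scaleC mult.commute)
  show "\<exists>K. \<forall>(c::complex) x::'a. norm (c *\<^sub>C x) \<le> norm c * norm x * K"
    by (rule exI[of _ 1]) (simp add: norm_scaleC)
qed (simp_all add: scaleC_add_left scaleC_add_right)

interpretation scaleC: bounded_bilinear "scaleC :: complex \<Rightarrow> 'a::complex_banach \<Rightarrow> 'a"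
  by (rule bounded_bilinear_scaleC)

lemma scaleC_one [simp]: "1 *\<^sub>C (x::'a::complex_banach) = x"
  using scaleC_of_real[of 1 x] by simp

lemmas scaleC_zero_left [simp] = scaleC.zero_left
lemmas scaleC_zero_right [simp] = scaleC.zero_right

lemma scaleC_eq_0_iff [simp]: "c *\<^sub>C (x::'a::complex_banach) = 0 \<longleftrightarrow> c = 0 \<or> x = 0"
  by (metis norm_scaleC mult_eq_0_iff norm_eq_zero)

lemma scaleC_right_cancel:
  "(x::'a::complex_banach) \<noteq> 0 \<Longrightarrow> c *\<^sub>C x = d *\<^sub>C x \<longleftrightarrow> c = d"
  by (metis scaleC.diff_left scaleC_eq_0_iff eq_iff_diff_eq_0)

lemma clinear_add: "clinear T \<Longrightarrow> T (x + y) = T x + T y"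
  and clinear_scaleC: "clinear T \<Longrightarrow> T (c *\<^sub>C x) = c *\<^sub>C T x"
  by (simp_all add: clinear_def)

lemma clinear_linear: "clinear T \<Longrightarrow> linear T"
  by (rule linearI) (simp_all add: clinear_add clinear_scaleC scaleC_of_real[symmetric])

lemma clinear_0: "clinear T \<Longrightarrow> T 0 = 0"
  and clinear_diff: "clinear T \<Longrightarrow> T (x - y) = T x - T y"
  and clinear_minus: "clinear T \<Longrightarrow> T (- x) = - T x"
  by (simp_all add: linear_0 linear_diff linear_neg clinear_linear)

lemma bounded_clinear_bounded_linear:
  assumes "bounded_clinear T"
  shows "bounded_linear T"
proof -
  have T: "clinear T" using assms by (simp add: bounded_clinear_def)
  obtain K where "\<And>x. norm (T x) \<le> K * norm x"
    using assms by (auto simp: bounded_clinear_def)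
  then show ?thesis
    by (intro bounded_linear_intro[of T K])
      (simp_all add: clinear_add[OF T] linear_scale[OF clinear_linear[OF T]] mult.commute)
qed

lemma bounded_clinear_obtain_bound:
  assumes "bounded_clinear T"
  obtains r where "0 \<le> r" "\<And>x. norm (T x) \<le> r * norm x"
proof -
  obtain K where K: "\<And>x. norm (T x) \<le> K * norm x"
    using assms by (auto simp: bounded_clinear_def)
  have "norm (T x) \<le> max 0 K * norm x" for x
    using K[of x] mult_right_mono[of K "max 0 K" "norm x"] by simp
  then show thesis by (intro that[of "max 0 K"]) auto
qed

section \<open>Power series in a bounded operator\<close>

definition power_series_op ::
    "(nat \<Rightarrow> complex) \<Rightarrow> ('a::complex_banach \<Rightarrow> 'a) \<Rightarrow> 'a \<Rightarrow> 'a" where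
  "power_series_op \<alpha> K x = (\<Sum>n. \<alpha> n *\<^sub>C (K ^^ n) x)"

lemma op_exp_power_series: "op_exp z T = power_series_op (\<lambda>n. z ^ n / fact n) T"
  by (simp add: fun_eq_iff op_exp_def power_series_op_def)

text \<open>\<open>r\<close> is any bound for the operator, not necessarily its norm. Convergence of
  a series then reduces to the scalar condition that \<open>cmod (\<alpha> n) * r ^ n\<close> be
  summable.\<close>

locale bounded_operator =
  fixes K :: "'a::complex_banach \<Rightarrow> 'a" and r :: real
  assumes lin: "clinear K" and bound: "norm (K x) \<le> r * norm x" and r_nonneg: "0 \<le> r"
begin

lemma bounded_linear: "bounded_linear K"
  by (rule bounded_clinear_bounded_linear) (auto simp: bounded_clinear_def lin bound intro: exI[of _ r])

lemma clinear_power: "clinear (K ^^ n)"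
  by (induction n) (simp_all add: clinear_def lin[unfolded clinear_def])

lemma norm_power_le: "norm ((K ^^ n) x) \<le> r ^ n * norm x"
proof (induction n)
  case (Suc n)
  have "norm ((K ^^ Suc n) x) \<le> r * norm ((K ^^ n) x)"
    by (simp add: bound)
  also have "\<dots> \<le> r * (r ^ n * norm x)"
    by (intro mult_left_mono Suc r_nonneg)
  finally show ?case by (simp add: mult.assoc)
qed simp

lemma bounded_linear_power: "bounded_linear (K ^^ n)"
  by (rule bounded_clinear_bounded_linear)
    (auto simp: bounded_clinear_def clinear_power norm_power_le intro: exI[of _ "r ^ n"])

lemma norm_term_le: "norm (\<alpha> n *\<^sub>C (K ^^ n) x) \<le> (cmod (\<alpha> n) * r ^ n) * norm x"
  using mult_left_mono[OF norm_power_le[of n x] norm_ge_zero[of "\<alpha> n"]]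
  by (simp add: norm_scaleC mult.assoc)

lemma summable_norm_terms:
  assumes "summable (\<lambda>n. cmod (\<alpha> n) * r ^ n)"
  shows "summable (\<lambda>n. norm (\<alpha> n *\<^sub>C (K ^^ n) x))"
  by (rule summable_comparison_test'[OF summable_mult2[OF assms, of "norm x"]])
    (use norm_term_le in simp)

lemma power_series_sums:
  assumes "summable (\<lambda>n. cmod (\<alpha> n) * r ^ n)"
  shows "(\<lambda>n. \<alpha> n *\<^sub>C (K ^^ n) x) sums power_series_op \<alpha> K x"
  unfolding power_series_op_def
  by (rule summable_sums[OF summable_norm_cancel[OF summable_norm_terms[OF assms]]])

lemma power_series_has_sum:
  assumes "summable (\<lambda>n. cmod (\<alpha> n) * r ^ n)"
  shows "((\<lambda>n. \<alpha> n *\<^sub>C (K ^^ n) x) has_sum power_series_op \<alpha> K x) UNIV"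
  by (rule norm_summable_imp_has_sum[OF summable_norm_terms[OF assms] power_series_sums[OF assms]])

lemma clinear_power_series:
  assumes "summable (\<lambda>n. cmod (\<alpha> n) * r ^ n)"
  shows "clinear (power_series_op \<alpha> K)"
  unfolding clinear_def
proof (intro conjI allI)
  fix x y c
  show "power_series_op \<alpha> K (x + y) = power_series_op \<alpha> K x + power_series_op \<alpha> K y"
    using sums_add[OF power_series_sums[OF assms, of x] power_series_sums[OF assms, of y]]
      sums_unique2[OF power_series_sums[OF assms, of "x + y"]]
    by (simp add: clinear_add[OF clinear_power] scaleC_add_right)
  have "(\<lambda>n. c *\<^sub>C (\<alpha> n *\<^sub>C (K ^^ n) x)) sums (c *\<^sub>C power_series_op \<alpha> K x)"
    by (rule bounded_linear.sums[OF scaleC.bounded_linear_right power_series_sums[OF assms]])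
  then show "power_series_op \<alpha> K (c *\<^sub>C x) = c *\<^sub>C power_series_op \<alpha> K x"
    using sums_unique2[OF power_series_sums[OF assms, of "c *\<^sub>C x"]]
    by (simp add: clinear_scaleC[OF clinear_power] scaleC_scaleC mult.commute)
qed

lemma power_series_op_commute:
  assumes "summable (\<lambda>n. cmod (\<alpha> n) * r ^ n)" "bounded_clinear S" "\<And>x. S (K x) = K (S x)"
  shows "S (power_series_op \<alpha> K x) = power_series_op \<alpha> K (S x)"
proof -
  have S: "clinear S" using assms(2) by (simp add: bounded_clinear_def)
  have comm: "S ((K ^^ n) y) = (K ^^ n) (S y)" for n y
    by (induction n arbitrary: y) (simp_all add: assms(3))
  have "(\<lambda>n. S (\<alpha> n *\<^sub>C (K ^^ n) x)) sums S (power_series_op \<alpha> K x)"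
    by (rule bounded_linear.sums[OF bounded_clinear_bounded_linear[OF assms(2)] power_series_sums[OF assms(1)]])
  moreover have "(\<lambda>n. S (\<alpha> n *\<^sub>C (K ^^ n) x)) = (\<lambda>n. \<alpha> n *\<^sub>C (K ^^ n) (S x))"
    by (simp add: clinear_scaleC[OF S] comm)
  ultimately show ?thesis
    using sums_unique2[OF power_series_sums[OF assms(1), of "S x"]] by simp
qed

text \<open>The Cauchy product. The double family of terms is absolutely summable, so it may be
  summed by rows, which gives the composition, or along antidiagonals, which gives the
  convolution.\<close>

lemma power_series_op_mult:
  assumes \<alpha>: "summable (\<lambda>n. cmod (\<alpha> n) * r ^ n)" and \<beta>: "summable (\<lambda>n. cmod (\<beta> n) * r ^ n)"
  shows "power_series_op \<alpha> K (power_series_op \<beta> K x) =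
    power_series_op (\<lambda>n. \<Sum>i\<le>n. \<alpha> i * \<beta> (n - i)) K x"
proof -
  define h where "h = (\<lambda>(i, j). (\<alpha> i * \<beta> j) *\<^sub>C (K ^^ (i + j)) x)"
  have terms: "\<alpha> i *\<^sub>C (K ^^ i) (\<beta> j *\<^sub>C (K ^^ j) x) = h (i, j)" for i j
    by (simp add: h_def clinear_scaleC[OF clinear_power] scaleC_scaleC funpow_add)
  have row: "((\<lambda>j. h (i, j)) has_sum \<alpha> i *\<^sub>C (K ^^ i) (power_series_op \<beta> K x)) UNIV" for i
    using has_sum_bounded_linear[OF bounded_linear_compose[OF scaleC.bounded_linear_right
          bounded_linear_power] power_series_has_sum[OF \<beta>, of x], of "\<alpha> i" i]
    by (simp add: terms)
  have absA: "(\<lambda>i. cmod (\<alpha> i) * r ^ i) summable_on UNIV"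
    "(\<lambda>i. cmod (\<beta> i) * r ^ i) summable_on UNIV"
    using \<alpha> \<beta> r_nonneg by (auto intro!: norm_summable_imp_summable_on)
  have "(\<lambda>(i, j). (cmod (\<alpha> i) * r ^ i) * (cmod (\<beta> j) * r ^ j)) summable_on UNIV \<times> UNIV"
    using absA r_nonneg
    by (intro summable_on_SigmaI[where g = "\<lambda>i. (cmod (\<alpha> i) * r ^ i) * infsum (\<lambda>j. cmod (\<beta> j) * r ^ j) UNIV"])
      (auto intro!: has_sum_cmult_right summable_on_cmult_left)
  then have "(\<lambda>p. norm x * (case p of (i, j) \<Rightarrow> (cmod (\<alpha> i) * r ^ i) * (cmod (\<beta> j) * r ^ j)))
      summable_on UNIV \<times> UNIV"
    by (rule summable_on_cmult_right)
  then have "(\<lambda>p. norm (h p)) summable_on UNIV \<times> UNIV"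
  proof (rule Infinite_Sum.abs_summable_on_comparison_test')
    fix p :: "nat \<times> nat"
    show "norm (h p) \<le> norm x * (case p of (i, j) \<Rightarrow> (cmod (\<alpha> i) * r ^ i) * (cmod (\<beta> j) * r ^ j))"
      using norm_term_le[of "\<lambda>_. \<alpha> (fst p) * \<beta> (snd p)" "fst p + snd p" x]
      by (simp add: h_def split_def norm_mult power_add mult_ac)
  qed
  then have summ: "h summable_on UNIV \<times> UNIV"
    by (rule abs_summable_summable)
  then obtain s where s: "(h has_sum s) (UNIV \<times> UNIV)"
    by (auto simp: summable_on_def)
  have lhs: "((\<lambda>i. \<alpha> i *\<^sub>C (K ^^ i) (power_series_op \<beta> K x)) has_sum s) UNIV"
    by (rule has_sum_SigmaD[OF s]) (use row in auto)
  \<comment> \<open>The pair \<open>(i, j)\<close> is indexed by its antidiagonal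
    \<open>n = i + j\<close> together with \<open>i\<close>.\<close>
  have bij: "bij_betw (\<lambda>(n, i). (i, n - i)) (SIGMA n:UNIV. {..n}) (UNIV \<times> (UNIV :: nat set))"
    by (rule bij_betwI[where g = "\<lambda>(i, j). (i + j, i)"]) auto
  have "((\<lambda>p. h (case p of (n, i) \<Rightarrow> (i, n - i))) has_sum s) (SIGMA n:UNIV. {..n})"
    using s by (subst has_sum_reindex_bij_betw[OF bij]) simp
  then have rhs: "((\<lambda>n. \<Sum>i\<le>n. h (i, n - i)) has_sum s) UNIV"
    by (rule has_sum_SigmaD) (auto intro!: has_sum_finiteI)
  have "power_series_op \<alpha> K (power_series_op \<beta> K x) = s"
    unfolding power_series_op_def[of \<alpha>]
    by (rule sums_unique[symmetric, OF has_sum_imp_sums[OF lhs]])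
  moreover have "(\<Sum>i\<le>n. h (i, n - i)) = (\<Sum>i\<le>n. \<alpha> i * \<beta> (n - i)) *\<^sub>C (K ^^ n) x" for n
    by (simp add: h_def scaleC.sum_left)
  then have "power_series_op (\<lambda>n. \<Sum>i\<le>n. \<alpha> i * \<beta> (n - i)) K x = s"
    unfolding power_series_op_def using sums_unique[OF has_sum_imp_sums[OF rhs]] by simp
  ultimately show ?thesis by simp
qed

lemma summable_exp_terms: "summable (\<lambda>n. cmod (z ^ n / fact n) * r ^ n)"
proof -
  have "summable (\<lambda>n. (cmod z * r) ^ n /\<^sub>R fact n)"
    by (rule summable_exp_generic)
  then show ?thesis
    by (simp add: norm_divide norm_power norm_mult norm_inverse power_mult_distrib divide_inverse mult_ac)
qed

lemma op_exp_add: "op_exp z K (op_exp w K x) = op_exp (z + w) K x"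
proof -
  have "(\<Sum>i\<le>n. z ^ i / fact i * (w ^ (n - i) / fact (n - i))) = (z + w) ^ n / fact n" for n
    using exp_series_add_commuting[of z w n]
    by (simp add: scaleR_conv_of_real divide_inverse mult_ac)
  then show ?thesis
    unfolding op_exp_power_series
    by (subst power_series_op_mult) (simp_all only: summable_exp_terms)
qed

lemma op_exp_0: "op_exp 0 K x = x"
proof -
  have "op_exp 0 K x = (\<Sum>n. if n = 0 then x else 0)"
    unfolding op_exp_def by (intro suminf_cong) auto
  also have "\<dots> = x" by (rule sums_unique[symmetric, OF sums_single[of 0 "\<lambda>_. x"]])
  finally show ?thesis .
qed

text \<open>A quadratic remainder bound, used later to recover the operator as the derivative of its
  exponential group at 0.\<close>

lemma op_exp_linear_approx:
  assumes "cmod z \<le> 1"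
  shows "norm (op_exp z K x - x - z *\<^sub>C K x) \<le> (cmod z)\<^sup>2 * (r\<^sup>2 * exp r * norm x)"
proof -
  let ?f = "\<lambda>n. (z ^ n / fact n) *\<^sub>C (K ^^ n) x"
  have f: "?f sums op_exp z K x"
    unfolding op_exp_power_series by (rule power_series_sums[OF summable_exp_terms])
  have tail: "(\<lambda>n. ?f (n + 2)) sums (op_exp z K x - x - z *\<^sub>C K x)"
    using sums_split_initial_segment[OF f, of 2]
    by (simp add: numeral_2_eq_2 algebra_simps)
  have "(\<lambda>n. r ^ n /\<^sub>R fact n) sums exp r"
    by (rule exp_converges)
  then have e: "(\<lambda>n. ((cmod z)\<^sup>2 * r\<^sup>2 * norm x) * (r ^ n /\<^sub>R fact n)) sums (((cmod z)\<^sup>2 * r\<^sup>2 * norm x) * exp r)"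
    by (rule sums_mult)
  \<comment> \<open>Two powers of \<open>z\<close> are kept and the others bounded by 1; replacing
    \<open>fact (n + 2)\<close> by \<open>fact n\<close> leaves the exponential series of
    \<open>r\<close>.\<close>
  have le: "norm (?f (n + 2)) \<le> ((cmod z)\<^sup>2 * r\<^sup>2 * norm x) * (r ^ n /\<^sub>R fact n)" for n
  proof -
    have "norm (?f (n + 2)) \<le> (cmod z ^ (n + 2) / fact (n + 2) * r ^ (n + 2)) * norm x"
      using norm_term_le[of "\<lambda>n. z ^ n / fact n" "n + 2" x]
      by (simp only: norm_divide norm_power norm_fact)
    also have "cmod z ^ (n + 2) / fact (n + 2) \<le> (cmod z)\<^sup>2 / fact n"
    proof (intro frac_le)
      show "cmod z ^ (n + 2) \<le> (cmod z)\<^sup>2"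
        using assms by (intro power_decreasing) auto
      show "(fact n :: real) \<le> fact (n + 2)" by (rule fact_mono) simp
    qed auto
    finally show ?thesis
      using r_nonneg by (simp add: mult_right_mono power_add divide_inverse mult_ac power2_eq_square)
  qed
  have s: "summable (\<lambda>n. norm (?f (n + 2)))"
    by (rule summable_comparison_test'[OF sums_summable[OF e]]) (use le in simp)
  have "norm (op_exp z K x - x - z *\<^sub>C K x) \<le> (\<Sum>n. norm (?f (n + 2)))"
    using summable_norm[OF s] sums_unique[OF tail] by simp
  also have "\<dots> \<le> ((cmod z)\<^sup>2 * r\<^sup>2 * norm x) * exp r"
    using suminf_le[OF le s sums_summable[OF e]] sums_unique[OF e] by simp
  finally show ?thesis by (simp add: mult_ac)
qed

end

section \<open>The Taylor coefficients of \<open>sqrt (1 - x)\<close>\<close>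

definition sqrt_coeff :: "nat \<Rightarrow> real" where
  "sqrt_coeff k = (1 / 2 gchoose k) * (- 1) ^ k"

lemma sqrt_coeff_0: "sqrt_coeff 0 = 1"
  by (simp add: sqrt_coeff_def)

text \<open>The coefficient is a rising product started at -1/2: its first factor is negative and
  all the others are positive.\<close>

lemma sqrt_coeff_Suc_nonpos: "sqrt_coeff (Suc k) \<le> 0"
proof -
  have "sqrt_coeff (Suc k) = pochhammer (- 1 / 2) (Suc k) / fact (Suc k)"
    by (simp add: sqrt_coeff_def gbinomial_pochhammer power_mult_distrib[symmetric])
  also have "\<dots> = - (1 / 2) * pochhammer (1 / 2) k / fact (Suc k)"
    by (simp add: pochhammer_rec)
  also have "\<dots> \<le> 0"
    using pochhammer_pos[of "1 / 2 :: real" k] by (simp add: divide_nonpos_pos)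
  finally show ?thesis .
qed

text \<open>An alternating partial sum of binomial coefficients is again, up to sign, a binomial
  coefficient, here a rising product started at 1/2.\<close>

lemma sqrt_coeff_partial_sum_nonneg: "0 \<le> (\<Sum>k\<le>m. sqrt_coeff k)"
proof -
  have "(\<Sum>k\<le>m. sqrt_coeff k) = (- 1) ^ m * (- (1 / 2) gchoose m)"
    using gbinomial_sum_lower_neg[of "1 / 2 :: real" m] by (simp add: sqrt_coeff_def)
  also have "\<dots> = pochhammer (1 / 2) m / fact m"
    by (simp add: gbinomial_pochhammer power_mult_distrib[symmetric])
  also have "\<dots> \<ge> 0"
    using pochhammer_pos[of "1 / 2 :: real" m] by simp
  finally show ?thesis .
qed

text \<open>Only the coefficient at 0 is positive, so a partial sum of absolute values is 2 minus a
  nonnegative partial sum. This is convergence at the boundary point 1, as required for an operator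
  known only to be a contraction.\<close>

lemma summable_sqrt_coeff: "summable (\<lambda>k. \<bar>sqrt_coeff k\<bar>)"
proof (rule bounded_imp_summable)
  fix n
  have "\<bar>sqrt_coeff k\<bar> = 2 * (if k = 0 then 1 else 0) - sqrt_coeff k" for k
    using sqrt_coeff_Suc_nonpos[of "k - 1"] by (cases k) (auto simp: sqrt_coeff_0)
  then have "(\<Sum>k\<le>n. \<bar>sqrt_coeff k\<bar>) = 2 - (\<Sum>k\<le>n. sqrt_coeff k)"
    by (simp add: sum_subtractf sum_distrib_left[symmetric])
  then show "(\<Sum>k\<le>n. \<bar>sqrt_coeff k\<bar>) \<le> 2"
    using sqrt_coeff_partial_sum_nonneg[of n] by simp
qed simp

text \<open>The square of \<open>sqrt (1 - x)\<close> is \<open>1 - x\<close>; on coefficients this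
  is the Vandermonde identity for 1/2 + 1/2 = 1.\<close>

lemma sqrt_coeff_convolution:
  "(\<Sum>i\<le>n. sqrt_coeff i * sqrt_coeff (n - i)) = (if n = 0 then 1 else if n = 1 then - 1 else 0)"
proof -
  have "(\<Sum>i\<le>n. sqrt_coeff i * sqrt_coeff (n - i))
      = (\<Sum>i\<le>n. ((1/2 :: real) gchoose i) * (1/2 gchoose (n - i))) * (- 1) ^ n"
    unfolding sum_distrib_right
    by (intro sum.cong) (auto simp: sqrt_coeff_def power_add[symmetric])
  also have "\<dots> = ((1 :: real) gchoose n) * (- 1) ^ n"
    using gbinomial_Vandermonde[of "1/2 :: real" "1/2" n] by (simp add: atMost_atLeast0)
  also have "\<dots> = (if n = 0 then 1 else if n = 1 then - 1 else 0)"
    using binomial_gbinomial[of 1 n, where ?'a = real] by (cases n) (auto simp: binomial_eq_0)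
  finally show ?thesis .
qed

section \<open>The cyclic subtriple of an element\<close>

context jbstar_triple
begin

lemma tp_add_right: "tp a b (c + c') = tp a b c + tp a b c'"
  by (metis tp_add_left tp_sym)

lemma tp_scaleC_right: "tp a b (s *\<^sub>C c) = s *\<^sub>C tp a b c"
  by (metis tp_scaleC_left tp_sym)

lemma clinear_left: "clinear (\<lambda>x. tp x b c)"
  and clinear_right: "clinear (\<lambda>x. tp a b x)"
  by (simp_all add: clinear_def tp_add_left tp_scaleC_left tp_add_right tp_scaleC_right)

lemma linear_mid: "linear (\<lambda>x. tp a x c)"
  by (rule linearI) (simp_all add: tp_add_mid tp_scaleC_mid scaleC_of_real[symmetric])

lemma tp_zero [simp]: "tp 0 b c = 0" "tp a 0 c = 0" "tp a b 0 = 0"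
  using clinear_0[OF clinear_left] clinear_0[OF clinear_right] linear_0[OF linear_mid]
  by blast+

lemma tendsto_tp:
  assumes "(f \<longlongrightarrow> a) F" "(g \<longlongrightarrow> b) F" "(h \<longlongrightarrow> c) F"
  shows "((\<lambda>x. tp (f x) (g x) (h x)) \<longlongrightarrow> tp a b c) F"
proof -
  have "isCont (\<lambda>(a, b, c). tp a b c) (a, b, c)"
    using tp_continuous by (simp add: continuous_on_eq_continuous_at)
  then have "((\<lambda>x. (\<lambda>(a, b, c). tp a b c) (f x, g x, h x)) \<longlongrightarrow> (\<lambda>(a, b, c). tp a b c) (a, b, c)) F"
    by (rule isCont_tendsto_compose) (intro tendsto_intros assms)
  then show ?thesis by simp
qed

lemma jordan: "tp a b (tp x y z) = tp x y (tp a b z) + tp (tp a b x) y z - tp x (tp b a y) z"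
  using jordan_identity[of a b x y z] by (simp add: L_op_def)

lemma bounded_clinear_L: "bounded_clinear (tp a a)"
  using L_op_hermitian[of a] by (simp add: hermitian_op_def L_op_def)

lemma isometric_exp: "norm (op_exp (\<i> * of_real t) (tp a a) x) = norm x"
  using L_op_hermitian[of a] by (simp add: hermitian_op_def L_op_def)

end

locale cyclic_subtriple = jbstar_triple tp
  for tp :: "'a::complex_banach tprod" +
  fixes a :: 'a
begin

definition T :: "'a \<Rightarrow> 'a" where "T = tp a a"

text \<open>In Jordan notation, the odd power of \<open>a\<close> with exponent
  \<open>2 * n + 1\<close>.\<close>

definition p :: "nat \<Rightarrow> 'a" where "p n = (T ^^ n) a"

lemma p_0 [simp]: "p 0 = a" and T_p: "T (p n) = p (Suc n)"
  by (simp_all add: p_def)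

lemma clinear_T: "clinear T"
  unfolding T_def by (rule clinear_right)

lemma T_commutator: "T (tp x y z) - tp x y (T z) = tp (T x) y z - tp x (T y) z"
  unfolding T_def by (simp add: jordan[of a a x y z])

text \<open>Induction on the total degree \<open>k\<close>. If \<open>T\<close> commutes with all
  operators \<open>L(p i, p j)\<close> of degree \<open>k\<close>, the derivation rule
  \<open>T_commutator\<close> allows one factor \<open>T\<close> to move from \<open>p i\<close> to
  \<open>p j\<close>, so all operators of degree \<open>k + 1\<close> coincide. That they commute
  with \<open>T\<close> comes from counting one difference in two ways.\<close>

lemma power_associativity:
  "m + n = k \<Longrightarrow> tp (p m) (p n) = tp (p k) a \<and> (\<forall>z. T (tp (p m) (p n) z) = tp (p m) (p n) (T z))"
proof (induction k arbitrary: m n)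
  case 0
  then show ?case by (simp add: T_def)
next
  case (Suc k)
  have step: "tp (p (Suc i)) (p j) = tp (p i) (p (Suc j))" if "i + j = k" for i j
  proof
    fix z
    show "tp (p (Suc i)) (p j) z = tp (p i) (p (Suc j)) z"
      using T_commutator[of "p i" "p j" z] conjunct2[OF Suc.IH[OF that]] by (simp add: T_p)
  qed
  have eq: "tp (p i) (p j) = tp (p (Suc k)) a" if "i + j = Suc k" for i j
    using that
  proof (induction j arbitrary: i)
    case (Suc j)
    then show ?case using step[of i j] by simp
  qed simp
  \<comment> \<open>The commutator \<open>X\<close> of \<open>T\<close> and
    \<open>?\<Lambda>\<close> is compared with \<open>L(p (k + 2), a) - L(a, p (k + 2))\<close>,
    which turns out to be both \<open>(k + 2) X\<close> and \<open>- X\<close>.\<close>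
  let ?\<Lambda> = "tp (p (Suc k)) a"
  define X where "X z = T (?\<Lambda> z) - ?\<Lambda> (T z)" for z
  have X: "tp (p (Suc i)) (p j) z - tp (p i) (p (Suc j)) z = X z" if "i + j = Suc k" for i j z
    using T_commutator[of "p i" "p j" z] eq[OF that] by (simp add: T_p X_def)
  \<comment> \<open>Each shift of a factor \<open>T\<close> to the middle variable costs one
    \<open>X\<close>; the sum is built downwards from \<open>j = k + 2\<close>, where both sides
    vanish. Only \<open>j = 0\<close> is used.\<close>
  have tele: "tp (p (Suc k + 1 - j)) (p j) z - tp a (p (Suc k + 1)) z = of_nat (Suc k + 1 - j) *\<^sub>C X z"
    if "j \<le> Suc k + 1" for j z
    using that
  proof (induction j rule: inc_induct)
    case (step j)
    have "tp (p (Suc k + 1 - j)) (p j) z - tp (p (Suc k + 1 - Suc j)) (p (Suc j)) z = X z"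
      using X[of "Suc k + 1 - Suc j" j z] step.hyps by (simp add: Suc_diff_le)
    moreover have "of_nat (Suc k + 1 - j) *\<^sub>C X z = of_nat (Suc k + 1 - Suc j) *\<^sub>C X z + 1 *\<^sub>C X z"
      unfolding scaleC_add_left[symmetric] using step.hyps by (simp add: of_nat_diff algebra_simps)
    ultimately show ?case using step.IH by (simp add: algebra_simps)
  qed simp
  have up: "tp (p (Suc k)) a a = p (Suc k + 1)"
    using tp_sym[of "p (Suc k)" a a] T_p[of "Suc k"] by (simp add: T_def)
  have mid: "tp a (p (Suc k)) a = p (Suc k + 1)"
    using eq[of 0 "Suc k"] up by simp
  \<comment> \<open>The second count: the Jordan identity for \<open>L(p (k + 1), a)\<close> acting
    on \<open>{a, a, z}\<close>, with the inner products of powers evaluated by \<open>up\<close>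
    and \<open>mid\<close>.\<close>
  have "X z = tp a (p (Suc k + 1)) z - tp (p (Suc k + 1)) a z" for z
    using jordan[of "p (Suc k)" a a a z] by (simp add: X_def T_def up mid)
  with tele[of 0] have "of_nat (Suc k + 1) *\<^sub>C X z = (- 1) *\<^sub>C X z" for z
    by (simp add: scaleC.minus_left)
  then have "(of_nat (Suc k + 1) - - 1) *\<^sub>C X z = 0" for z
    unfolding scaleC.diff_left by simp
  moreover have "of_nat (Suc k + 1) - - 1 \<noteq> (0 :: complex)"
    by (metis of_nat_Suc of_nat_neq_0 diff_minus_eq_add add.commute)
  ultimately have "X z = 0" for z
    by (metis scaleC_eq_0_iff)
  then show ?case using eq[OF Suc.prems] by (simp add: X_def)
qed

section \<open>The closed span of the powers and adjoints on it\<close>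

inductive_set M :: "'a set" where
  M_power: "p n \<in> M"
| M_add: "x \<in> M \<Longrightarrow> y \<in> M \<Longrightarrow> x + y \<in> M"
| M_scaleC: "x \<in> M \<Longrightarrow> c *\<^sub>C x \<in> M"
| M_limit: "(\<And>n. X n \<in> M) \<Longrightarrow> X \<longlonglongrightarrow> x \<Longrightarrow> x \<in> M"

lemma a_in_M: "a \<in> M"
  using M_power[of 0] by simp

lemma M_zero: "0 \<in> M"
  using M_scaleC[OF a_in_M, of 0] by simp

lemma tendsto_T: "(X \<longlongrightarrow> x) F \<Longrightarrow> ((\<lambda>n. T (X n)) \<longlongrightarrow> T x) F"
  unfolding T_def by (intro tendsto_tp tendsto_const)

lemma T_in_M: "x \<in> M \<Longrightarrow> T x \<in> M"
proof (induction rule: M.induct)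
  case (M_limit X x)
  then show ?case using M.M_limit[of "\<lambda>n. T (X n)"] tendsto_T by blast
qed (auto simp: clinear_add[OF clinear_T] clinear_scaleC[OF clinear_T] T_p intro: M.intros)

text \<open>On powers both sides equal \<open>L(p (m + n + 1), a)\<close>. Since limits are an
  introduction rule of \<open>M\<close>, one induction in each variable carries the identity to the
  closed span.\<close>

lemma T_symmetric:
  assumes "b \<in> M" "c \<in> M"
  shows "tp (T b) c z = tp b (T c) z"
  using assms
proof (induction b rule: M.induct)
  case (M_power m)
  then show ?case
  proof (induction c rule: M.induct)
    case (M_power n)
    show ?case
      using power_associativity[of "Suc m" n, OF refl] power_associativity[of m "Suc n", OF refl]
      by (simp add: T_p)
  next
    case (M_limit X x)
    have "(\<lambda>n. tp (T (p m)) (X n) z) \<longlonglongrightarrow> tp (T (p m)) x z"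
      by (intro tendsto_tp tendsto_const M_limit)
    moreover have "(\<lambda>n. tp (p m) (T (X n)) z) \<longlonglongrightarrow> tp (p m) (T x) z"
      by (intro tendsto_tp tendsto_const tendsto_T M_limit)
    ultimately show ?case using M_limit.IH LIMSEQ_unique by simp
  qed (simp_all add: tp_add_mid tp_scaleC_mid clinear_add[OF clinear_T] clinear_scaleC[OF clinear_T])
next
  case (M_limit X x)
  have "(\<lambda>n. tp (T (X n)) c z) \<longlonglongrightarrow> tp (T x) c z"
    by (intro tendsto_tp tendsto_const tendsto_T M_limit)
  moreover have "(\<lambda>n. tp (X n) (T c) z) \<longlonglongrightarrow> tp x (T c) z"
    by (intro tendsto_tp tendsto_const M_limit)
  ultimately show ?case using M_limit LIMSEQ_unique by simp
qed (simp_all add: tp_add_left tp_scaleC_left clinear_add[OF clinear_T] clinear_scaleC[OF clinear_T])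

text \<open>On \<open>M\<close> the operator-valued form \<open>L(b, c)\<close> takes the place of
  an inner product, and \<open>R'\<close> that of the adjoint of \<open>R\<close>.\<close>

definition adj :: "('a \<Rightarrow> 'a) \<Rightarrow> ('a \<Rightarrow> 'a) \<Rightarrow> bool" where
  "adj R R' \<longleftrightarrow> (\<forall>b\<in>M. R b \<in> M \<and> R' b \<in> M) \<and> (\<forall>b\<in>M. \<forall>c\<in>M. tp (R b) c = tp b (R' c))"

lemma adj_T: "adj T T"
  by (auto simp: adj_def T_in_M T_symmetric)

lemma adj_id: "adj (\<lambda>x. x) (\<lambda>x. x)"
  by (simp add: adj_def)

lemma adj_compose: "adj R R' \<Longrightarrow> adj S S' \<Longrightarrow> adj (\<lambda>x. R (S x)) (\<lambda>x. S' (R' x))"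
  by (simp add: adj_def)

lemma adj_funpow: "adj R R' \<Longrightarrow> adj (R ^^ n) (R' ^^ n)"
proof (induction n)
  case (Suc n)
  show ?case
    using adj_compose[OF Suc.prems Suc.IH[OF Suc.prems]]
    by (simp add: comp_def funpow_swap1[symmetric])
qed (simp add: adj_id id_def)

lemma adj_add: "adj R R' \<Longrightarrow> adj S S' \<Longrightarrow> adj (\<lambda>x. R x + S x) (\<lambda>x. R' x + S' x)"
  by (auto simp: adj_def M_add tp_add_left tp_add_mid fun_eq_iff)

lemma adj_scaleC: "adj R R' \<Longrightarrow> adj (\<lambda>x. c *\<^sub>C R x) (\<lambda>x. cnj c *\<^sub>C R' x)"
  by (auto simp: adj_def M_scaleC tp_scaleC_left tp_scaleC_mid fun_eq_iff)

lemma adj_diff: "adj R R' \<Longrightarrow> adj S S' \<Longrightarrow> adj (\<lambda>x. R x - S x) (\<lambda>x. R' x - S' x)"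
  using adj_add[of R R' "\<lambda>x. (- 1) *\<^sub>C S x" "\<lambda>x. (- 1) *\<^sub>C S' x"] adj_scaleC[of S S' "- 1"]
  by (simp add: scaleC.minus_left)

lemma adj_sum:
  assumes "\<And>i. adj (R i) (R' i)"
  shows "adj (\<lambda>x. \<Sum>i<n::nat. R i x) (\<lambda>x. \<Sum>i<n. R' i x)"
proof (induction n)
  case 0
  then show ?case by (auto simp: adj_def M_zero fun_eq_iff)
next
  case (Suc n)
  then show ?case using adj_add[OF Suc assms] by simp
qed

lemma adj_limit:
  assumes adj: "\<And>n. adj (R n) (R' n)"
    and lim: "\<And>x. (\<lambda>n. R n x) \<longlonglongrightarrow> S x" "\<And>x. (\<lambda>n. R' n x) \<longlonglongrightarrow> S' x"
  shows "adj S S'"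
  unfolding adj_def
proof (intro conjI ballI)
  fix b assume b: "b \<in> M"
  show "S b \<in> M" "S' b \<in> M"
    using adj b by (auto simp: adj_def intro!: M_limit[OF _ lim(1)] M_limit[OF _ lim(2)])
  fix c assume c: "c \<in> M"
  show "tp (S b) c = tp b (S' c)"
  proof
    fix z
    have "(\<lambda>n. tp (R n b) c z) \<longlonglongrightarrow> tp (S b) c z" "(\<lambda>n. tp b (R' n c) z) \<longlonglongrightarrow> tp b (S' c) z"
      by (intro tendsto_tp tendsto_const lim)+
    moreover have "tp (R n b) c z = tp b (R' n c) z" for n
      using adj b c by (simp add: adj_def)
    ultimately show "tp (S b) c z = tp b (S' c) z"
      using LIMSEQ_unique by simp
  qed
qed

text \<open>The coefficients are conjugated because the triple product is conjugate-linear in the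
  middle; the relation holds for partial sums and passes to the limit.\<close>

lemma adj_power_series:
  assumes "adj K K'" "bounded_operator K r" "bounded_operator K' r"
    and "summable (\<lambda>n. cmod (\<alpha> n) * r ^ n)"
  shows "adj (power_series_op \<alpha> K) (power_series_op (\<lambda>n. cnj (\<alpha> n)) K')"
proof (rule adj_limit)
  show "adj (\<lambda>x. \<Sum>i<n. \<alpha> i *\<^sub>C (K ^^ i) x) (\<lambda>x. \<Sum>i<n. cnj (\<alpha> i) *\<^sub>C (K' ^^ i) x)" for n
    by (intro adj_sum adj_scaleC adj_funpow assms)
qed (use bounded_operator.power_series_sums[OF assms(2) assms(4)]
    bounded_operator.power_series_sums[OF assms(3), of "\<lambda>n. cnj (\<alpha> n)"] assms(4)
    in \<open>auto simp: sums_def\<close>)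

end

section \<open>Elements of rank-one triples are multiples of tripotents\<close>

lemma closed_complex_line:
  fixes a :: "'a::complex_banach"
  assumes "a \<noteq> 0" "(\<lambda>n. c n *\<^sub>C a) \<longlonglongrightarrow> x"
  shows "\<exists>l. x = l *\<^sub>C a"
proof -
  have "Cauchy c"
  proof (rule CauchyI)
    fix e :: real assume "0 < e"
    then have "0 < e * norm a" using assms(1) by simp
    then obtain N where N: "\<And>m n. m \<ge> N \<Longrightarrow> n \<ge> N \<Longrightarrow> norm (c m *\<^sub>C a - c n *\<^sub>C a) < e * norm a"
      using CauchyD[OF LIMSEQ_imp_Cauchy[OF assms(2)]] by blast
    have "norm (c m - c n) < e" if "m \<ge> N" "n \<ge> N" for m n
      using N[OF that] assms(1) by (simp add: scaleC.diff_left[symmetric] norm_scaleC)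
    then show "\<exists>N. \<forall>m\<ge>N. \<forall>n\<ge>N. norm (c m - c n) < e" by blast
  qed
  then obtain l where "c \<longlonglongrightarrow> l" using Cauchy_convergent_iff convergent_def by blast
  then have "(\<lambda>n. c n *\<^sub>C a) \<longlonglongrightarrow> l *\<^sub>C a" by (intro scaleC.tendsto tendsto_const)
  then show ?thesis using assms(2) LIMSEQ_unique by blast
qed

lemma (in jbstar_triple) rank_one_orthogonal:
  assumes "rank_one tp" "tp x y = (\<lambda>_. 0)" "tp y x = (\<lambda>_. 0)"
  shows "x = 0 \<or> y = 0"
proof (rule ccontr)
  assume nz: "\<not> (x = 0 \<or> y = 0)"
  have "x \<noteq> y"
  proof
    assume "x = y"
    then have "tp x x x = 0" using assms(2) by simp
    then show False using norm_tp_cube[of x] nz by simp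
  qed
  have "orthogonal_subset tp {x, y}"
    using assms nz by (auto simp: orthogonal_subset_def triple_orthogonal_def L_op_def)
  then have "(card_of {x, y}, BNF_Cardinal_Arithmetic.cone) \<in> ordLeq"
    using assms(1) by (auto simp: rank_one_def has_rank_def bounds_orthogonal_def)
  \<comment> \<open>\<open>cone\<close> is the cardinal of \<open>{()}\<close>, so the rank bound
    injects the two orthogonal elements into a point.\<close>
  then have "\<exists>f. inj_on f {x, y} \<and> f ` {x, y} \<subseteq> {()}"
    unfolding BNF_Cardinal_Arithmetic.cone_def by (rule iffD2[OF card_of_ordLeq])
  then obtain f :: "'a \<Rightarrow> unit" where "inj_on f {x, y}"
    by (elim exE conjE)
  then have "x = y" by (rule inj_onD) simp_all
  with \<open>x \<noteq> y\<close> show False by contradiction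
qed

context cyclic_subtriple
begin

section \<open>The isometric group \<open>exp (i t T)\<close> and its trigonometric
  functions\<close>

definition U :: "real \<Rightarrow> 'a \<Rightarrow> 'a" where "U t = op_exp (\<i> * of_real t) T"

lemma bounded_operator_T: "\<exists>r. bounded_operator T r"
  using bounded_clinear_obtain_bound[OF bounded_clinear_L[of a]] clinear_T
  unfolding T_def bounded_operator_def by metis

lemma norm_U: "norm (U t x) = norm x"
  unfolding U_def T_def by (rule isometric_exp)

lemma U_add: "U s (U t x) = U (s + t) x"
  unfolding U_def using bounded_operator_T bounded_operator.op_exp_add
  by (metis of_real_add ring_class.ring_distribs(1))

lemma U_0: "U 0 x = x"
  unfolding U_def using bounded_operator_T bounded_operator.op_exp_0 by fastforce

lemma clinear_U: "clinear (U t)"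
proof -
  obtain r where r: "bounded_operator T r" using bounded_operator_T by blast
  show ?thesis
    unfolding U_def op_exp_power_series
    by (rule bounded_operator.clinear_power_series[OF r bounded_operator.summable_exp_terms[OF r]])
qed

lemma bounded_clinear_U: "bounded_clinear (U t)"
  by (auto simp: bounded_clinear_def clinear_U norm_U intro!: exI[of _ 1])

text \<open>Conjugating the coefficients of the exponential series turns \<open>\<i> * t\<close>
  into \<open>- \<i> * t\<close>.\<close>

lemma adj_U: "adj (U t) (U (- t))"
proof -
  obtain r where r: "bounded_operator T r" using bounded_operator_T by blast
  show ?thesis
    using adj_power_series[OF adj_T r r bounded_operator.summable_exp_terms[OF r, of "\<i> * of_real t"]]
    by (simp add: U_def op_exp_power_series)
qed

context
  fixes s :: real
begin

text \<open>With \<open>x = s T - \<theta>\<close>, these are \<open>cos x\<close>, \<open>sin x\<close>, \<open>(cos x)\<^sup>2\<close> and \<open>\<bar>sin x\<bar>\<close>, the last one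
  as \<open>sqrt (1 - (cos x)\<^sup>2)\<close>; its series converges because \<open>cos x\<close> is a contraction.\<close>

definition cos_op :: "real \<Rightarrow> 'a \<Rightarrow> 'a" where
  "cos_op \<theta> x = (1 / 2) *\<^sub>C (cis (- \<theta>) *\<^sub>C U s x + cis \<theta> *\<^sub>C U (- s) x)"

definition sin_op :: "real \<Rightarrow> 'a \<Rightarrow> 'a" where
  "sin_op \<theta> x = (- \<i> / 2) *\<^sub>C (cis (- \<theta>) *\<^sub>C U s x - cis \<theta> *\<^sub>C U (- s) x)"

definition cos2_op :: "real \<Rightarrow> 'a \<Rightarrow> 'a" where
  "cos2_op \<theta> x = cos_op \<theta> (cos_op \<theta> x)"

definition abs_sin_op :: "real \<Rightarrow> 'a \<Rightarrow> 'a" where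
  "abs_sin_op \<theta> = power_series_op (\<lambda>n. of_real (sqrt_coeff n)) (cos2_op \<theta>)"

lemma clinear_cos_op: "clinear (cos_op \<theta>)"
  unfolding clinear_def cos_op_def
  by (simp add: clinear_add[OF clinear_U] clinear_scaleC[OF clinear_U] scaleC_scaleC
      scaleC_add_right mult.commute add_ac)

lemma clinear_sin_op: "clinear (sin_op \<theta>)"
  unfolding clinear_def sin_op_def
  by (simp add: clinear_add[OF clinear_U] clinear_scaleC[OF clinear_U] scaleC_scaleC
      scaleC_add_right scaleC.diff_right mult.commute mult.left_commute algebra_simps)

lemma norm_cos_op_le: "norm (cos_op \<theta> x) \<le> norm x"
  using norm_triangle_ineq[of "cis (- \<theta>) *\<^sub>C U s x" "cis \<theta> *\<^sub>C U (- s) x"]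
  by (simp add: cos_op_def norm_scaleC norm_U norm_divide)

lemma norm_sin_op_le: "norm (sin_op \<theta> x) \<le> norm x"
  using norm_triangle_ineq4[of "cis (- \<theta>) *\<^sub>C U s x" "cis \<theta> *\<^sub>C U (- s) x"]
  by (simp add: sin_op_def norm_scaleC norm_U norm_divide)

lemma bounded_clinear_sin_op: "bounded_clinear (sin_op \<theta>)"
  unfolding bounded_clinear_def using clinear_sin_op norm_sin_op_le
  by (auto intro!: exI[of _ 1])

lemma bounded_operator_cos2_op: "bounded_operator (cos2_op \<theta>) 1"
proof
  show "clinear (cos2_op \<theta>)"
    using clinear_cos_op[of \<theta>] by (simp add: clinear_def cos2_op_def)
  show "norm (cos2_op \<theta> x) \<le> 1 * norm x" for x
    using norm_cos_op_le[of \<theta> x] norm_cos_op_le[of \<theta> "cos_op \<theta> x"] by (simp add: cos2_op_def)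
qed simp

lemma summable_sqrt_terms: "summable (\<lambda>n. cmod (of_real (sqrt_coeff n)) * 1 ^ n)"
  using summable_sqrt_coeff by simp

lemma U_inverse: "U s (U (- s) x) = x" "U (- s) (U s x) = x"
  by (simp_all add: U_add U_0)

lemma sin_op_cos_op_commute: "sin_op \<theta> (cos_op \<theta> x) = cos_op \<theta> (sin_op \<theta> x)"
  unfolding sin_op_def cos_op_def
  by (simp add: clinear_add[OF clinear_U] clinear_diff[OF clinear_U] clinear_scaleC[OF clinear_U]
      scaleC_scaleC scaleC_add_right scaleC.diff_right U_inverse cis_mult algebra_simps)

lemma sin_op_squared: "sin_op \<theta> (sin_op \<theta> x) = x - cos2_op \<theta> x"
proof -
  let ?A = "(cis (- \<theta>) * cis (- \<theta>)) *\<^sub>C U s (U s x)"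
  let ?B = "(cis \<theta> * cis \<theta>) *\<^sub>C U (- s) (U (- s) x)"
  have c: "cos2_op \<theta> x = (1 / 4) *\<^sub>C (?A + ?B + x + x)"
    unfolding cos2_op_def cos_op_def
    by (simp add: clinear_add[OF clinear_U] clinear_scaleC[OF clinear_U]
      scaleC_scaleC scaleC_add_right U_inverse cis_mult algebra_simps)
  have "sin_op \<theta> (sin_op \<theta> x) = (- 1 / 4) *\<^sub>C (?A + ?B - x - x)"
    unfolding sin_op_def
    by (simp add: clinear_add[OF clinear_U] clinear_diff[OF clinear_U] clinear_scaleC[OF clinear_U]
      scaleC_scaleC scaleC_add_right scaleC.diff_right U_inverse cis_mult algebra_simps)
  \<comment> \<open>The coefficient 1 of \<open>x\<close> is written as four quarters, to match the
    two copies of \<open>x\<close> in each formula.\<close>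
  also have "\<dots> = (1 / 4 + 1 / 4 + 1 / 4 + 1 / 4) *\<^sub>C x - cos2_op \<theta> x"
    unfolding c scaleC_add_left by (simp add: scaleC_add_right scaleC.diff_right scaleC.minus_left algebra_simps)
  finally show ?thesis by simp
qed

text \<open>Squaring the series for \<open>sqrt (1 - y)\<close> at
  \<open>y = cos2_op \<theta>\<close> convolves its coefficients, and only the terms of degree 0 and
  1 survive.\<close>

lemma abs_sin_op_squared: "abs_sin_op \<theta> (abs_sin_op \<theta> x) = x - cos2_op \<theta> x"
proof -
  interpret cos2: bounded_operator "cos2_op \<theta>" 1 by (rule bounded_operator_cos2_op)
  have conv: "(\<lambda>n. \<Sum>i\<le>n. of_real (sqrt_coeff i) * of_real (sqrt_coeff (n - i)))
      = (\<lambda>n. if n = 0 then 1 else if n = 1 then - 1 else 0 :: complex)"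
    unfolding of_real_mult[symmetric] of_real_sum[symmetric] sqrt_coeff_convolution by auto
  have "abs_sin_op \<theta> (abs_sin_op \<theta> x)
      = (\<Sum>n. (if n = 0 then 1 else if n = 1 then - 1 else 0) *\<^sub>C (cos2_op \<theta> ^^ n) x)"
    unfolding abs_sin_op_def cos2.power_series_op_mult[OF summable_sqrt_terms summable_sqrt_terms] conv
    by (simp add: power_series_op_def)
  also have "\<dots> = (\<Sum>n\<in>{0, 1}. (if n = 0 then 1 else if n = 1 then - 1 else 0) *\<^sub>C (cos2_op \<theta> ^^ n) x)"
    by (rule suminf_finite) auto
  finally show ?thesis by (simp add: scaleC.minus_left)
qed

lemma sin_op_abs_sin_op_commute: "sin_op \<theta> (abs_sin_op \<theta> x) = abs_sin_op \<theta> (sin_op \<theta> x)"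
  unfolding abs_sin_op_def
  by (rule bounded_operator.power_series_op_commute[OF bounded_operator_cos2_op summable_sqrt_terms
        bounded_clinear_sin_op]) (simp add: cos2_op_def sin_op_cos_op_commute)

lemma clinear_abs_sin_op: "clinear (abs_sin_op \<theta>)"
  unfolding abs_sin_op_def
  by (rule bounded_operator.clinear_power_series[OF bounded_operator_cos2_op summable_sqrt_terms])

text \<open>Taking adjoints exchanges the two exponential terms, so their sum is
  self-adjoint.\<close>

lemma adj_cos_op: "adj (cos_op \<theta>) (cos_op \<theta>)"
  using adj_scaleC[OF adj_add[OF adj_scaleC[OF adj_U[of s], of "cis (- \<theta>)"]
      adj_scaleC[OF adj_U[of "- s"], of "cis \<theta>"]], of "1 / 2"]
  by (simp add: cos_op_def[abs_def] cis_cnj add.commute)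

lemma adj_sin_op: "adj (sin_op \<theta>) (sin_op \<theta>)"
proof -
  \<comment> \<open>Here the exchange reverses a difference; the sign is absorbed by conjugating
    \<open>- \<i> / 2\<close>.\<close>
  have "(\<i> / 2) *\<^sub>C (y - z) = (- \<i> / 2) *\<^sub>C (z - y)" for y z :: 'a
    by (simp add: scaleC.diff_right scaleC.minus_left)
  then show ?thesis
    using adj_scaleC[OF adj_diff[OF adj_scaleC[OF adj_U[of s], of "cis (- \<theta>)"]
        adj_scaleC[OF adj_U[of "- s"], of "cis \<theta>"]], of "- \<i> / 2"]
    by (simp add: sin_op_def[abs_def] cis_cnj)
qed

lemma adj_abs_sin_op: "adj (abs_sin_op \<theta>) (abs_sin_op \<theta>)"
  using adj_power_series[OF _ bounded_operator_cos2_op bounded_operator_cos2_op summable_sqrt_terms]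
    adj_compose[OF adj_cos_op adj_cos_op]
  by (simp add: abs_sin_op_def cos2_op_def[abs_def])

text \<open>The positive and negative parts of \<open>sin x\<close> applied to \<open>a\<close> are orthogonal.\<close>

lemma sin_op_sign:
  assumes "rank_one tp"
  shows "abs_sin_op \<theta> a = sin_op \<theta> a \<or> abs_sin_op \<theta> a = - sin_op \<theta> a"
proof -
  let ?P = "\<lambda>x. abs_sin_op \<theta> x + sin_op \<theta> x" and ?N = "\<lambda>x. abs_sin_op \<theta> x - sin_op \<theta> x"
  have P: "adj ?P ?P" and N: "adj ?N ?N"
    by (intro adj_add adj_diff adj_abs_sin_op adj_sin_op)+
  \<comment> \<open>Both products are a difference of squares, and the squares of
    \<open>abs_sin_op\<close> and \<open>sin_op\<close> agree because the two operators commute and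
    both square to \<open>1 - cos2_op\<close>.\<close>
  have PN: "?P (?N x) = 0" and NP: "?N (?P x) = 0" for x
    by (simp_all add: clinear_diff[OF clinear_abs_sin_op] clinear_diff[OF clinear_sin_op]
        clinear_add[OF clinear_abs_sin_op] clinear_add[OF clinear_sin_op]
        sin_op_squared abs_sin_op_squared sin_op_abs_sin_op_commute)
  \<comment> \<open>Self-adjointness moves one factor across to the other, where the product of the
    two parts is 0.\<close>
  have "tp (?P a) (?N a) = tp a (?P (?N a))" "tp (?N a) (?P a) = tp a (?N (?P a))"
    using P N a_in_M unfolding adj_def by blast+
  then have "tp (?P a) (?N a) = (\<lambda>_. 0)" "tp (?N a) (?P a) = (\<lambda>_. 0)"
    unfolding PN NP by auto
  then have "?P a = 0 \<or> ?N a = 0"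
    by (rule rank_one_orthogonal[OF assms])
  then show ?thesis by (auto simp: add_eq_0_iff2)
qed

lemma cos_op_shift: "cos_op (\<theta> + pi) x = - cos_op \<theta> x"
  and sin_op_shift: "sin_op (\<theta> + pi) x = - sin_op \<theta> x"
proof -
  have shift: "cis (- (\<theta> + pi)) = - cis (- \<theta>)" "cis (\<theta> + pi) = - cis \<theta>"
    by (simp_all add: complex_eq_iff cos_diff sin_diff)
  then show "cos_op (\<theta> + pi) x = - cos_op \<theta> x" "sin_op (\<theta> + pi) x = - sin_op \<theta> x"
    unfolding cos_op_def sin_op_def shift
    by (simp_all add: scaleC.minus_left scaleC.minus_right scaleC_add_right scaleC.diff_right)
qed

lemma abs_sin_op_shift: "abs_sin_op (\<theta> + pi) = abs_sin_op \<theta>"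
proof -
  have "cos2_op (\<theta> + pi) = cos2_op \<theta>"
    by (simp add: fun_eq_iff cos2_op_def cos_op_shift clinear_minus[OF clinear_cos_op])
  then show ?thesis by (simp add: abs_sin_op_def)
qed

lemma continuous_on_U: "continuous_on A g \<Longrightarrow> continuous_on A (\<lambda>\<theta>. U t (g \<theta>))"
  using linear_continuous_on_compose bounded_clinear_bounded_linear[OF bounded_clinear_U]
    bounded_linear.continuous_on by blast

lemma continuous_on_cos_op: "continuous_on A g \<Longrightarrow> continuous_on A (\<lambda>\<theta>. cos_op \<theta> (g \<theta>))"
  unfolding cos_op_def cis_conv_exp
  by (intro scaleC.continuous_on continuous_intros continuous_on_U)

lemma continuous_on_sin_op: "continuous_on A (\<lambda>\<theta>. sin_op \<theta> x)"
  unfolding sin_op_def cis_conv_exp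
  by (intro scaleC.continuous_on continuous_intros continuous_on_U)

text \<open>Every \<open>cos2_op \<theta>\<close> is a contraction, so the series converges
  uniformly in \<open>\<theta>\<close>.\<close>

lemma continuous_on_abs_sin_op: "continuous_on A (\<lambda>\<theta>. abs_sin_op \<theta> x)"
proof (rule uniform_limit_theorem)
  have cont: "continuous_on A (\<lambda>\<theta>. (cos2_op \<theta> ^^ n) x)" for n
    by (induction n) (auto simp: cos2_op_def intro: continuous_on_cos_op)
  show "\<forall>\<^sub>F n in sequentially. continuous_on A
      (\<lambda>\<theta>. \<Sum>i<n. of_real (sqrt_coeff i) *\<^sub>C (cos2_op \<theta> ^^ i) x)"
    by (intro always_eventually allI continuous_on_sum scaleC.continuous_on continuous_on_const cont)
  show "uniform_limit A (\<lambda>n \<theta>. \<Sum>i<n. of_real (sqrt_coeff i) *\<^sub>C (cos2_op \<theta> ^^ i) x)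
      (\<lambda>\<theta>. abs_sin_op \<theta> x) sequentially"
    unfolding abs_sin_op_def power_series_op_def
  proof (rule Weierstrass_m_test)
    show "norm (of_real (sqrt_coeff n) *\<^sub>C (cos2_op \<theta> ^^ n) x) \<le> \<bar>sqrt_coeff n\<bar> * norm x" for n \<theta>
      using bounded_operator.norm_term_le[OF bounded_operator_cos2_op, of "\<lambda>n. of_real (sqrt_coeff n)" n \<theta> x]
      by simp
    show "summable (\<lambda>n. \<bar>sqrt_coeff n\<bar> * norm x)"
      by (rule summable_mult2[OF summable_sqrt_coeff])
  qed
qed simp

lemma sin_op_root:
  assumes "rank_one tp"
  shows "\<exists>\<theta>. sin_op \<theta> a = 0"
proof -
  define P where "P = {\<theta>. abs_sin_op \<theta> a = sin_op \<theta> a}"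
  define N where "N = {\<theta>. abs_sin_op \<theta> a = - sin_op \<theta> a}"
  have cover: "UNIV \<subseteq> P \<union> N"
    using sin_op_sign[OF assms] by (auto simp: P_def N_def)
  have closed: "closed P" "closed N"
    unfolding P_def N_def
    by (intro closed_Collect_eq continuous_on_abs_sin_op continuous_on_minus continuous_on_sin_op)+
  have shift: "\<theta> + pi \<in> P \<longleftrightarrow> \<theta> \<in> N" "\<theta> + pi \<in> N \<longleftrightarrow> \<theta> \<in> P" for \<theta>
    by (simp_all add: P_def N_def abs_sin_op_shift sin_op_shift)
  \<comment> \<open>Translation by \<open>pi\<close> exchanges \<open>P\<close> and
    \<open>N\<close>, and together they cover the line, so neither can be empty.\<close>
  have "P \<noteq> {}" "N \<noteq> {}"
    using cover shift[of 0] by (metis Un_iff UNIV_I empty_iff subsetD)+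
  then have "P \<inter> N \<noteq> {}"
    using connected_UNIV[where ?'a = real] closed cover unfolding connected_closed
    by (metis inf_top.right_neutral inf_top.left_neutral)
  then obtain \<theta> where "\<theta> \<in> P" "\<theta> \<in> N" by blast
  then have "sin_op \<theta> a = - sin_op \<theta> a"
    by (simp add: P_def N_def)
  then have "(1 + 1) *\<^sub>C sin_op \<theta> a = 0"
    unfolding scaleC_add_left by (simp add: eq_neg_iff_add_eq_0)
  then show ?thesis by auto
qed

text \<open>If \<open>sin (s T - \<theta>) a = 0\<close>, the two exponentials agree at
  \<open>a\<close>; applying \<open>U s\<close> once more gives the eigenvalue
  \<open>exp (2 \<i> \<theta>)\<close>.\<close>

lemma U_double_eigen:
  assumes "rank_one tp"
  shows "\<exists>\<mu>. U (2 * s) a = \<mu> *\<^sub>C a"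
proof -
  obtain \<theta> where "sin_op \<theta> a = 0" using sin_op_root[OF assms] by blast
  then have "cis (- \<theta>) *\<^sub>C U s a = cis \<theta> *\<^sub>C U (- s) a"
    by (simp add: sin_op_def)
  then have "U s (cis (- \<theta>) *\<^sub>C U s a) = U s (cis \<theta> *\<^sub>C U (- s) a)"
    by simp
  then have "cis (- \<theta>) *\<^sub>C U (2 * s) a = cis \<theta> *\<^sub>C a"
    by (simp add: clinear_scaleC[OF clinear_U] U_add U_0)
  then have "cis \<theta> *\<^sub>C cis (- \<theta>) *\<^sub>C U (2 * s) a = cis \<theta> *\<^sub>C cis \<theta> *\<^sub>C a"
    by simp
  then show ?thesis by (auto simp: scaleC_scaleC cis_mult)
qed

end

text \<open>The difference quotients of \<open>U t a\<close> at \<open>t = 0\<close> are multiples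
  of \<open>a\<close> and converge to \<open>\<i> *\<^sub>C T a\<close>; a complex line is
  closed.\<close>

lemma eigen:
  assumes "rank_one tp" "a \<noteq> 0"
  shows "\<exists>l. T a = l *\<^sub>C a"
proof -
  obtain r where r: "bounded_operator T r" using bounded_operator_T by blast
  define t :: "nat \<Rightarrow> real" where "t n = 1 / real (Suc n)" for n
  have t: "0 < t n" "t n \<le> 1" for n by (simp_all add: t_def)
  have "\<exists>\<mu>. U (t n) a = \<mu> *\<^sub>C a" for n
    using U_double_eigen[OF assms(1), of "t n / 2"] by simp
  then obtain \<mu> where \<mu>: "\<And>n. U (t n) a = \<mu> n *\<^sub>C a" by metis
  define K where "K = r\<^sup>2 * exp r * norm a"
  define c where "c n = (\<mu> n - 1) / of_real (t n)" for n
  have le: "norm (c n *\<^sub>C a - \<i> *\<^sub>C T a) \<le> t n * K" for n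
  proof -
    have tn: "of_real (t n) \<noteq> (0 :: complex)" using t(1)[of n] by simp
    have "t n * norm (c n *\<^sub>C a - \<i> *\<^sub>C T a) = norm (of_real (t n) *\<^sub>C (c n *\<^sub>C a - \<i> *\<^sub>C T a))"
      using t(1)[of n] by (simp add: norm_scaleC)
    also have "of_real (t n) *\<^sub>C (c n *\<^sub>C a - \<i> *\<^sub>C T a) = U (t n) a - a - (\<i> * of_real (t n)) *\<^sub>C T a"
      using tn by (simp add: scaleC.diff_right scaleC_scaleC c_def \<mu> scaleC.diff_left mult.commute)
    also have "norm \<dots> \<le> (cmod (\<i> * of_real (t n)))\<^sup>2 * K"
      unfolding U_def K_def
      by (rule bounded_operator.op_exp_linear_approx[OF r]) (use t[of n] in \<open>simp add: norm_mult\<close>)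
    also have "\<dots> = t n * (t n * K)"
      by (simp add: norm_mult power2_eq_square)
    finally show ?thesis using t(1)[of n] by simp
  qed
  have "(\<lambda>n. t n * K) \<longlonglongrightarrow> 0"
    unfolding t_def using tendsto_mult_left_zero[OF LIMSEQ_inverse_real_of_nat, of K]
    by (simp add: inverse_eq_divide)
  with always_eventually[OF allI[OF le]]
  have "(\<lambda>n. c n *\<^sub>C a - \<i> *\<^sub>C T a) \<longlonglongrightarrow> 0"
    by (rule Lim_null_comparison)
  then have "(\<lambda>n. c n *\<^sub>C a) \<longlonglongrightarrow> \<i> *\<^sub>C T a"
    by (rule LIM_zero_cancel)
  then obtain l where "\<i> *\<^sub>C T a = l *\<^sub>C a"
    using closed_complex_line[OF assms(2)] by blast
  then have "(- \<i>) *\<^sub>C \<i> *\<^sub>C T a = (- \<i>) *\<^sub>C l *\<^sub>C a" by simp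
  then show ?thesis by (auto simp: scaleC_scaleC)
qed

end

text \<open>The eigenvalue of \<open>L(a, a)\<close> at \<open>a\<close> lies in the spectrum, hence
  is a nonnegative real, and the norm axiom for cubes then determines it.\<close>

lemma (in jbstar_triple) rank_one_cube:
  assumes "rank_one tp"
  shows "tp a a a = of_real ((norm a)\<^sup>2) *\<^sub>C a"
proof (cases "a = 0")
  case False
  interpret cyclic_subtriple tp a ..
  obtain \<kappa> where \<kappa>: "tp a a a = \<kappa> *\<^sub>C a" using eigen[OF assms False] by (auto simp: T_def)
  have "\<kappa> \<in> op_spectrum (L_op tp a a)"
  proof (rule ccontr)
    assume "\<kappa> \<notin> op_spectrum (L_op tp a a)"
    \<comment> \<open>A left inverse of \<open>L(a, a) - \<kappa>\<close> would send 0 to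
      \<open>a\<close>.\<close>
    then obtain S where S: "bounded_clinear S" "S (tp a a a - \<kappa> *\<^sub>C a) = a"
      unfolding op_spectrum_def L_op_def by blast
    then have "a = 0"
      using clinear_0[of S] by (simp add: \<kappa> bounded_clinear_def)
    then show False using False by simp
  qed
  then have "\<kappa> \<in> \<real>\<^sub>\<ge>\<^sub>0" using L_op_nonneg_spectrum by blast
  then obtain l where l: "\<kappa> = of_real l" "0 \<le> l" by (auto elim: nonneg_Reals_cases)
  have "l * norm a = norm a ^ 3"
    using norm_tp_cube[of a] l by (simp add: \<kappa> norm_scaleC)
  then have "l = (norm a)\<^sup>2" using False by (simp add: power3_eq_cube power2_eq_square)
  then show ?thesis using \<kappa> l by simp
qed simp

section \<open>Complex Hilbert spaces\<close>

text \<open>Completeness comes from the type class, so \<open>ip_self\<close> makes the space a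
  Hilbert space in its given norm.\<close>

locale complex_inner_product =
  fixes ip :: "'a::complex_banach \<Rightarrow> 'a \<Rightarrow> complex"
  assumes ip_add_left: "ip (x + y) z = ip x z + ip y z"
    and ip_scaleC_left: "ip (c *\<^sub>C x) z = c * ip x z"
    and ip_commute: "ip y x = cnj (ip x y)"
    and ip_self: "ip x x = of_real ((norm x)\<^sup>2)"
begin

lemma ip_add_right: "ip x (y + z) = ip x y + ip x z"
  using ip_add_left[of y z x] ip_commute[of x] by simp

lemma ip_scaleC_right: "ip x (c *\<^sub>C y) = cnj c * ip x y"
  using ip_scaleC_left[of c y x] ip_commute[of x] by simp

lemma ip_scaleR_left: "ip (r *\<^sub>R x) y = r *\<^sub>R ip x y"
  using ip_scaleC_left[of "of_real r" x y] by (simp add: scaleC_of_real scaleR_conv_of_real)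

lemma linear_ip_left: "linear (\<lambda>x. ip x y)"
  by (rule linearI) (simp_all add: ip_add_left ip_scaleR_left)

lemma ip_diff_left: "ip (x - y) z = ip x z - ip y z"
  using linear_diff[OF linear_ip_left] .

lemma ip_zero_left [simp]: "ip 0 z = 0"
  using linear_0[OF linear_ip_left] .

lemma ip_diff_right: "ip x (y - z) = ip x y - ip x z"
  using ip_diff_left[of y z x] ip_commute[of x] by simp

lemma ip_zero_right [simp]: "ip x 0 = 0"
  using ip_commute[of x 0] by simp

lemma norm_sq_diff_scaleC:
  "(norm (x - c *\<^sub>C y))\<^sup>2 = (norm x)\<^sup>2 + (cmod c)\<^sup>2 * (norm y)\<^sup>2 - 2 * Re (cnj c * ip x y)"
proof -
  have "complex_of_real ((norm (x - c *\<^sub>C y))\<^sup>2)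
      = of_real ((norm x)\<^sup>2) + (c * cnj c) * of_real ((norm y)\<^sup>2) - (cnj c * ip x y + cnj (cnj c * ip x y))"
    unfolding ip_self[symmetric] using ip_commute[of y x]
    by (simp add: ip_diff_left ip_diff_right ip_scaleC_left ip_scaleC_right algebra_simps)
  also have "\<dots> = of_real ((norm x)\<^sup>2 + (cmod c)\<^sup>2 * (norm y)\<^sup>2 - 2 * Re (cnj c * ip x y))"
    unfolding complex_add_cnj complex_norm_square[symmetric] by simp
  finally show ?thesis by (simp only: of_real_eq_iff)
qed

lemma norm_sq_diff: "(norm (x - y))\<^sup>2 = (norm x)\<^sup>2 + (norm y)\<^sup>2 - 2 * Re (ip x y)"
  using norm_sq_diff_scaleC[of x 1 y] by simp

lemma norm_sq_add: "(norm (x + y))\<^sup>2 = (norm x)\<^sup>2 + (norm y)\<^sup>2 + 2 * Re (ip x y)"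
  using norm_sq_diff_scaleC[of x "- 1" y] by (simp add: scaleC.minus_left)

text \<open>The scalar is the coefficient of the orthogonal projection of \<open>x\<close> onto the
  line of \<open>y\<close>. Both the Cauchy-Schwarz inequality and the orthogonality criterion below
  use this choice.\<close>

lemma norm_sq_diff_proj:
  assumes "y \<noteq> 0"
  shows "(norm (x - (ip x y / of_real ((norm y)\<^sup>2)) *\<^sub>C y))\<^sup>2 = (norm x)\<^sup>2 - (cmod (ip x y))\<^sup>2 / (norm y)\<^sup>2"
proof -
  have re: "Re (cnj (ip x y / of_real ((norm y)\<^sup>2)) * ip x y) = (cmod (ip x y))\<^sup>2 / (norm y)\<^sup>2"
    unfolding cmod_power2 by (simp add: power2_eq_square add_divide_distrib)
  have sq: "(cmod (ip x y / of_real ((norm y)\<^sup>2)))\<^sup>2 * (norm y)\<^sup>2 = (cmod (ip x y))\<^sup>2 / (norm y)\<^sup>2"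
    using assms by (simp only: norm_divide norm_of_real) (simp add: power2_eq_square)
  show ?thesis
    unfolding norm_sq_diff_scaleC re sq by simp
qed

lemma Cauchy_Schwarz: "cmod (ip x y) \<le> norm x * norm y"
proof (cases "y = 0")
  case False
  have "0 \<le> (norm x)\<^sup>2 - (cmod (ip x y))\<^sup>2 / (norm y)\<^sup>2"
    using norm_sq_diff_proj[OF False, of x] zero_le_power2 by metis
  then have "(cmod (ip x y))\<^sup>2 \<le> (norm x * norm y)\<^sup>2"
    using False by (simp add: field_simps power_mult_distrib)
  then show ?thesis by (rule power2_le_imp_le) simp
qed simp

lemma bounded_linear_ip_left: "bounded_linear (\<lambda>x. ip x y)"
  by (rule bounded_linear_intro[of _ "norm y"]) (simp_all add: ip_add_left ip_scaleR_left Cauchy_Schwarz)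

section \<open>Orthogonal projection and Riesz representation\<close>

lemma orthogonal_if_minimal:
  assumes "\<And>c. norm u \<le> norm (u - c *\<^sub>C v)"
  shows "ip u v = 0"
proof (cases "v = 0")
  case False
  have "(norm u)\<^sup>2 \<le> (norm u)\<^sup>2 - (cmod (ip u v))\<^sup>2 / (norm v)\<^sup>2"
    unfolding norm_sq_diff_proj[OF False, of u, symmetric] by (rule power_mono[OF assms norm_ge_zero])
  then show ?thesis using False by (simp add: divide_le_0_iff)
qed simp

text \<open>A minimizing sequence for the distance from \<open>x\<close> to \<open>W\<close> is
  Cauchy, and its limit is a nearest point; minimality along every line
  \<open>l + c *\<^sub>C v\<close> in \<open>W\<close> gives orthogonality.\<close>

theorem projection:
  assumes W: "closed W" "0 \<in> W" "\<And>v w. v \<in> W \<Longrightarrow> w \<in> W \<Longrightarrow> v + w \<in> W" "\<And>c v. v \<in> W \<Longrightarrow> c *\<^sub>C v \<in> W"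
  obtains w where "w \<in> W" "\<And>v. v \<in> W \<Longrightarrow> ip (x - w) v = 0"
proof -
  define d where "d = (INF w\<in>W. (norm (x - w))\<^sup>2)"
  have bdd: "bdd_below ((\<lambda>w. (norm (x - w))\<^sup>2) ` W)" by (rule bdd_belowI2[of _ 0]) simp
  have d_le: "d \<le> (norm (x - w))\<^sup>2" if "w \<in> W" for w
    unfolding d_def by (rule cINF_lower[OF bdd that])
  have "\<exists>w\<in>W. (norm (x - w))\<^sup>2 < d + inverse (real (Suc n))" for n
    using cINF_less_iff[of W "\<lambda>w. (norm (x - w))\<^sup>2"] bdd W(2) unfolding d_def[symmetric]
    by (metis empty_iff inverse_positive_iff_positive less_add_same_cancel1 of_nat_0_less_iff zero_less_Suc)
  then obtain w where w: "\<And>n. w n \<in> W" "\<And>n. (norm (x - w n))\<^sup>2 < d + inverse (real (Suc n))"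
    by metis
  \<comment> \<open>Parallelogram law: \<open>?u + ?v\<close> is twice the difference of
    \<open>x\<close> and the midpoint of \<open>w n\<close> and \<open>w m\<close>. The midpoint is
    in \<open>W\<close>, so the square of its norm is at least \<open>4 * d\<close>.\<close>
  have est: "(norm (w n - w m))\<^sup>2 \<le> 2 * inverse (real (Suc n)) + 2 * inverse (real (Suc m))" for n m
  proof -
    let ?u = "x - w n" and ?v = "x - w m"
    have "(1/2 :: complex) *\<^sub>C (w n + w m) \<in> W" using w(1) W by blast
    then have "d \<le> (norm (x - (1/2 :: complex) *\<^sub>C (w n + w m)))\<^sup>2" by (rule d_le)
    also have "x - (1/2 :: complex) *\<^sub>C (w n + w m) = (1/2 :: complex) *\<^sub>C (?u + ?v)"
    proof -
      have "x = (1/2 :: complex) *\<^sub>C (x + x)"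
        by (simp add: scaleC_add_right scaleC_add_left[symmetric])
      then show ?thesis by (simp add: scaleC_add_right scaleC.diff_right)
    qed
    also have "(norm ((1/2 :: complex) *\<^sub>C (?u + ?v)))\<^sup>2 = (norm (?u + ?v))\<^sup>2 / 4"
      by (simp add: norm_scaleC power_mult_distrib power2_eq_square)
    finally have "4 * d \<le> (norm (?u + ?v))\<^sup>2" by simp
    moreover have "(norm (?u + ?v))\<^sup>2 + (norm (?u - ?v))\<^sup>2 = 2 * (norm ?u)\<^sup>2 + 2 * (norm ?v)\<^sup>2"
      unfolding norm_sq_add norm_sq_diff[of ?u ?v] by simp
    moreover have "norm (?u - ?v) = norm (w n - w m)" by (simp add: norm_minus_commute)
    ultimately show ?thesis using w(2)[of n] w(2)[of m] by simp
  qed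
  have "Cauchy w"
  proof (rule CauchyI)
    fix e :: real assume e: "0 < e"
    then have "0 < e\<^sup>2 / 4" by simp
    then obtain N where N: "inverse (real (Suc N)) < e\<^sup>2 / 4" using reals_Archimedean by blast
    have "norm (w m - w n) < e" if "m \<ge> N" "n \<ge> N" for m n
    proof -
      have "inverse (real (Suc m)) \<le> inverse (real (Suc N))" "inverse (real (Suc n)) \<le> inverse (real (Suc N))"
        using that by (auto intro!: le_imp_inverse_le)
      then have "(norm (w m - w n))\<^sup>2 < e\<^sup>2" using est[of m n] N by linarith
      then show ?thesis by (rule power2_less_imp_less) (use e in simp)
    qed
    then show "\<exists>N. \<forall>m\<ge>N. \<forall>n\<ge>N. norm (w m - w n) < e" by blast
  qed
  then obtain l where l: "w \<longlonglongrightarrow> l" using Cauchy_convergent_iff convergent_def by blast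
  have lW: "l \<in> W" using closed_sequentially[OF W(1)] w(1) l by blast
  have "(\<lambda>n. (norm (x - w n))\<^sup>2) \<longlonglongrightarrow> (norm (x - l))\<^sup>2" by (intro tendsto_intros l)
  moreover have "(\<lambda>n. d + inverse (real (Suc n))) \<longlonglongrightarrow> d + 0"
    by (intro tendsto_intros LIMSEQ_inverse_real_of_nat)
  ultimately have ld: "(norm (x - l))\<^sup>2 \<le> d + 0"
    by (rule LIMSEQ_le) (use w(2) less_imp_le in blast)
  show thesis
  proof (rule that[OF lW], rule orthogonal_if_minimal)
    fix v c assume "v \<in> W"
    then have "l + c *\<^sub>C v \<in> W" using W lW by blast
    then have "d \<le> (norm (x - l - c *\<^sub>C v))\<^sup>2" using d_le[of "l + c *\<^sub>C v"] by (simp add: algebra_simps)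
    then have "(norm (x - l))\<^sup>2 \<le> (norm (x - l - c *\<^sub>C v))\<^sup>2" using ld by linarith
    then show "norm (x - l) \<le> norm (x - l - c *\<^sub>C v)" by (rule power2_le_imp_le) simp
  qed
qed

text \<open>The component \<open>u\<close> of a vector orthogonal to the kernel of \<open>f\<close>
  represents \<open>f\<close> up to a scalar, since \<open>z - (f z / f u) *\<^sub>C u\<close>
  always lies in the kernel.\<close>

theorem Riesz:
  assumes f: "bounded_linear f" and fC: "\<And>c x. f (c *\<^sub>C x) = c * f x"
  obtains y where "\<And>x. f x = ip x y"
proof (cases "\<forall>x. f x = 0")
  case True
  then show thesis using that[of 0] by simp
next
  case False
  interpret f: bounded_linear f by (rule f)
  obtain x where x: "f x \<noteq> 0" using False by blast
  have "closed {v. f v = 0}"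
    by (intro closed_Collect_eq f.continuous_on continuous_on_id continuous_on_const)
  then obtain w where w: "f w = 0" "\<And>v. f v = 0 \<Longrightarrow> ip (x - w) v = 0"
    using projection[of "{v. f v = 0}" x] by (auto simp: f.zero f.add fC)
  define u where "u = x - w"
  have fu: "f u \<noteq> 0" using x w by (simp add: u_def f.diff)
  then have u0: "u \<noteq> 0" using f.zero by auto
  show thesis
  proof (rule that)
    fix z
    have "f (z - (f z / f u) *\<^sub>C u) = 0" using fu by (simp add: f.diff fC)
    then have "ip u (z - (f z / f u) *\<^sub>C u) = 0" using w(2) by (simp add: u_def)
    then have "ip (z - (f z / f u) *\<^sub>C u) u = 0" using ip_commute[of _ u] by simp
    then have "ip z u = f z / f u * of_real ((norm u)\<^sup>2)"
      by (simp add: ip_diff_left ip_scaleC_left ip_self)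
    then show "f z = ip z (cnj (f u / of_real ((norm u)\<^sup>2)) *\<^sub>C u)"
      using u0 fu by (simp add: ip_scaleC_right field_simps)
  qed
qed

section \<open>The dual of a Hilbert space is its only predual\<close>

definition functional :: "'a \<Rightarrow> 'a \<Rightarrow>\<^sub>L complex" where
  "functional y = Blinfun (\<lambda>x. ip x y)"

lemma functional_apply [simp]: "blinfun_apply (functional y) x = ip x y"
  unfolding functional_def by (simp add: bounded_linear_Blinfun_apply bounded_linear_ip_left)

lemma functional_in_cdual: "functional y \<in> cdual"
  by (simp add: cdual_def ip_scaleC_left)

lemma cdual_functional:
  assumes "f \<in> cdual"
  obtains y where "f = functional y"
proof -
  obtain y where "\<And>x. blinfun_apply f x = ip x y"
    using Riesz[OF blinfun.bounded_linear_right[of f]] assms by (auto simp: cdual_def)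
  then show thesis by (intro that[of y] blinfun_eqI) simp
qed

lemma norm_functional: "norm (functional y) = norm y"
proof (rule antisym)
  show "norm (functional y) \<le> norm y"
    by (rule norm_blinfun_bound) (simp_all add: Cauchy_Schwarz mult.commute)
  have "norm y * norm y \<le> norm (functional y) * norm y"
    using norm_blinfun[of "functional y" y] by (simp add: ip_self power2_eq_square norm_mult)
  then show "norm y \<le> norm (functional y)"
    by (cases "y = 0") simp_all
qed

lemma functional_add: "functional (y + z) = functional y + functional z"
  and functional_diff: "functional (y - z) = functional y - functional z"
  and functional_scaleC: "functional (c *\<^sub>C y) = blinfun_mult_right (cnj c) o\<^sub>L functional y"
  by (rule blinfun_eqI; simp add: blinfun.add_left blinfun.diff_left ip_add_right ip_diff_right ip_scaleC_right)+

lemma functional_0: "functional 0 = 0"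
  by (rule blinfun_eqI) simp

lemma closed_cdual: "closed (cdual :: ('a \<Rightarrow>\<^sub>L complex) set)"
proof -
  have closed: "closed {f :: 'a \<Rightarrow>\<^sub>L complex. blinfun_apply f (c *\<^sub>C x) = c * blinfun_apply f x}" for c x
    by (intro closed_Collect_eq continuous_intros)
  have eq: "cdual = (\<Inter>c. \<Inter>x. {f :: 'a \<Rightarrow>\<^sub>L complex. blinfun_apply f (c *\<^sub>C x) = c * blinfun_apply f x})"
    by (auto simp: cdual_def)
  show ?thesis unfolding eq by (intro closed_INT ballI closed)
qed

lemma Sup_cdual_ball:
  fixes x :: 'a
  shows "(SUP f\<in>{f \<in> cdual. norm f \<le> 1}. cmod (blinfun_apply f x)) = norm x"
proof (rule cSup_eq_maximum)
  show "norm x \<in> (\<lambda>f. cmod (blinfun_apply f x)) ` {f \<in> cdual. norm f \<le> 1}"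
  proof (rule image_eqI)
    \<comment> \<open>The supremum is attained at the normalized vector; for \<open>x = 0\<close>
      the inverse is 0 and \<open>?f\<close> is the zero functional.\<close>
    let ?f = "functional (of_real (inverse (norm x)) *\<^sub>C x)"
    show "norm x = cmod (blinfun_apply ?f x)"
      by (cases "x = 0") (simp_all add: ip_scaleC_right ip_self norm_mult norm_inverse power2_eq_square)
    show "?f \<in> {f \<in> cdual. norm f \<le> 1}"
      by (cases "x = 0") (simp_all add: functional_in_cdual norm_functional norm_scaleC norm_inverse)
  qed
next
  fix r assume "r \<in> (\<lambda>f. cmod (blinfun_apply f x)) ` {f \<in> cdual. norm f \<le> 1}"
  then obtain f :: "'a \<Rightarrow>\<^sub>L complex" where f: "r = cmod (blinfun_apply f x)" "norm f \<le> 1" by blast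
  then show "r \<le> norm x"
    using norm_blinfun[of f x] mult_right_mono[OF f(2), of "norm x"] by simp
qed

lemma is_predual_cdual: "is_predual (cdual :: ('a \<Rightarrow>\<^sub>L complex) set)"
  unfolding is_predual_def
proof (intro conjI allI impI)
  show "closed (cdual :: ('a \<Rightarrow>\<^sub>L complex) set)" by (rule closed_cdual)
  show "(SUP f\<in>{f \<in> cdual. norm f \<le> 1}. cmod (blinfun_apply f x)) = norm x" for x :: 'a
    by (rule Sup_cdual_ball)
  fix g :: "('a \<Rightarrow>\<^sub>L complex) \<Rightarrow> complex"
  assume "(\<forall>f\<in>cdual. \<forall>h\<in>cdual. g (f + h) = g f + g h) \<and>
    (\<forall>c. \<forall>f\<in>cdual. g (blinfun_mult_right c o\<^sub>L f) = c * g f) \<and> (\<exists>K. \<forall>f\<in>cdual. cmod (g f) \<le> K * norm f)"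
  then obtain K where add: "\<And>f h. f \<in> cdual \<Longrightarrow> h \<in> cdual \<Longrightarrow> g (f + h) = g f + g h"
    and mult: "\<And>c f. f \<in> cdual \<Longrightarrow> g (blinfun_mult_right c o\<^sub>L f) = c * g f"
    and K: "\<And>f. f \<in> cdual \<Longrightarrow> cmod (g f) \<le> K * norm f" by blast
  \<comment> \<open>\<open>functional\<close> is conjugate-linear, so the conjugate restores
    linearity and the Riesz theorem applies.\<close>
  define h where "h y = cnj (g (functional y))" for y
  have h_scaleC: "h (c *\<^sub>C y) = c * h y" for c y
    by (simp add: h_def functional_scaleC mult[OF functional_in_cdual])
  have "bounded_linear h"
  proof (rule bounded_linear_intro)
    show "h (x + y) = h x + h y" for x y
      by (simp add: h_def functional_add add functional_in_cdual)
    show "h (r *\<^sub>R x) = r *\<^sub>R h x" for r x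
      using h_scaleC[of "of_real r" x] by (simp add: scaleC_of_real scaleR_conv_of_real)
    show "norm (h x) \<le> norm x * K" for x
      using K[OF functional_in_cdual, of x] by (simp add: h_def norm_functional mult.commute)
  qed
  then obtain x where x: "\<And>y. h y = ip y x" using Riesz h_scaleC by blast
  show "\<exists>x. \<forall>f\<in>cdual. g f = blinfun_apply f x"
  proof (intro exI[of _ x] ballI)
    fix f :: "'a \<Rightarrow>\<^sub>L complex" assume "f \<in> cdual"
    then obtain y where y: "f = functional y" by (rule cdual_functional)
    have "g f = cnj (h y)" by (simp add: h_def y)
    also have "\<dots> = ip x y" using ip_commute[of x y] by (simp add: x)
    finally show "g f = blinfun_apply f x" by (simp add: y)
  qed
qed (auto simp: cdual_def blinfun.add_left algebra_simps)

text \<open>If \<open>V\<close> were smaller than the dual, some vector \<open>x - w\<close> would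
  be orthogonal to everything representing \<open>V\<close>; but \<open>V\<close> computes norms, so
  \<open>x = w\<close>.\<close>

lemma is_predual_unique:
  assumes V: "is_predual (V :: ('a \<Rightarrow>\<^sub>L complex) set)"
  shows "V = cdual"
proof
  show sub: "V \<subseteq> cdual" using V by (simp add: is_predual_def)
  show "cdual \<subseteq> V"
  proof
    fix f :: "'a \<Rightarrow>\<^sub>L complex" assume "f \<in> cdual"
    then obtain x where x: "f = functional x" by (rule cdual_functional)
    let ?W = "{y. functional y \<in> V}"
    have zeroV: "0 \<in> V" using V by (simp add: is_predual_def)
    have cont: "continuous_on UNIV functional"
      unfolding continuous_on_iff dist_norm functional_diff[symmetric] norm_functional by blast
    have closedW: "closed ?W"
      using V closed_vimage[of V functional] cont by (simp add: is_predual_def vimage_def)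
    have addW: "v + w \<in> ?W" if "v \<in> ?W" "w \<in> ?W" for v w
      using V that by (simp add: is_predual_def functional_add)
    have scaleW: "c *\<^sub>C v \<in> ?W" if "v \<in> ?W" for v c
      using V that by (simp add: is_predual_def functional_scaleC)
    have zeroW: "0 \<in> ?W" using zeroV by (simp add: functional_0)
    obtain w where w: "w \<in> ?W" "\<And>v. v \<in> ?W \<Longrightarrow> ip (x - w) v = 0"
      by (rule projection[of ?W x, OF closedW zeroW addW scaleW]) blast+
    have "cmod (blinfun_apply g (x - w)) = 0" if g: "g \<in> V" for g
    proof -
      obtain y where y: "g = functional y" using g sub cdual_functional by blast
      then show ?thesis using w(2)[of y] g by simp
    qed
    then have "(\<lambda>g. cmod (blinfun_apply g (x - w))) ` {g \<in> V. norm g \<le> 1} = {0}"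
      using zeroV by (auto intro!: image_eqI[of _ _ 0])
    moreover have "(SUP g\<in>{g \<in> V. norm g \<le> 1}. cmod (blinfun_apply g (x - w))) = norm (x - w)"
      using V by (simp add: is_predual_def)
    ultimately have "norm (x - w) = 0" by simp
    then show "f \<in> V" using w(1) by (simp add: x)
  qed
qed

lemma predual_eq_cdual: "(predual :: ('a \<Rightarrow>\<^sub>L complex) set) = cdual"
  unfolding predual_def using is_predual_cdual is_predual_unique by (rule the_equality)

text \<open>Evaluation at \<open>e\<close> turns a convex combination into an average of real parts
  that are at most 1 and average to 1, so both equal 1. In the unit ball only \<open>e\<close>
  itself attains this.\<close>

lemma functional_extreme_point:
  assumes e: "norm e = 1"
  shows "functional e extreme_point_of {f \<in> cdual. norm f \<le> 1}"
  unfolding extreme_point_of_def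
proof (intro conjI ballI notI)
  show "functional e \<in> {f \<in> cdual. norm f \<le> 1}"
    by (simp add: functional_in_cdual norm_functional e)
  fix f g assume f: "f \<in> {f \<in> cdual. norm f \<le> 1}" and g: "g \<in> {f \<in> cdual. norm f \<le> 1}"
    and seg: "functional e \<in> open_segment f g"
  obtain y where y: "f = functional y" using f cdual_functional by blast
  obtain z where z: "g = functional z" using g cdual_functional by blast
  have le: "norm y \<le> 1" "norm z \<le> 1" using f g by (simp_all add: y z norm_functional)
  obtain t where t: "0 < t" "t < 1" "functional e = (1 - t) *\<^sub>R f + t *\<^sub>R g" and ne: "f \<noteq> g"
    using seg by (auto simp: in_segment)
  have "Re (ip e e) = (1 - t) * Re (ip e y) + t * Re (ip e z)"
    using arg_cong[OF t(3), of "\<lambda>h. Re (blinfun_apply h e)"]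
    by (simp add: y z blinfun.add_left blinfun.scaleR_left)
  then have one: "1 = (1 - t) * Re (ip e y) + t * Re (ip e z)"
    by (simp add: ip_self e)
  have bound: "Re (ip e v) \<le> 1" if "norm v \<le> 1" for v
    using complex_Re_le_cmod[of "ip e v"] Cauchy_Schwarz[of e v] that by (simp add: e)
  have "(1 - t) * Re (ip e y) \<le> 1 - t" "t * Re (ip e z) \<le> t"
    using mult_left_mono[OF bound[OF le(1)], of "1 - t"] mult_left_mono[OF bound[OF le(2)], of t] t by auto
  then have "(1 - t) * Re (ip e y) = 1 - t" "t * Re (ip e z) = t" using one by linarith+
  then have re: "Re (ip e y) = 1" "Re (ip e z) = 1" using t by auto
  have "e = v" if "norm v \<le> 1" "Re (ip e v) = 1" for v
  proof -
    have "(norm (e - v))\<^sup>2 = (norm v)\<^sup>2 - 1" using that by (simp add: norm_sq_diff e)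
    also have "\<dots> \<le> 0" using that(1) by (simp add: power_le_one)
    finally show ?thesis by simp
  qed
  then have "y = z" using le re by metis
  then show False using ne by (simp add: y z)
qed

end

section \<open>The inner product of a rank-one triple\<close>

text \<open>The polarization formula for a form linear in \<open>x\<close>. It uses the norm alone,
  so it is available before the norm is known to be Hilbertian.\<close>

definition polar_ip :: "'a::complex_banach \<Rightarrow> 'a \<Rightarrow> complex" where
  "polar_ip x y = (of_real ((norm (x + y))\<^sup>2 - (norm (x - y))\<^sup>2)
     + \<i> * of_real ((norm (x + \<i> *\<^sub>C y))\<^sup>2 - (norm (x - \<i> *\<^sub>C y))\<^sup>2)) / 4"

text \<open>It vanishes under the parallelogram law, as \<open>y\<close> and
  \<open>\<i> *\<^sub>C y\<close> have equal norms; it arises below as the coefficient of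
  \<open>b\<close>.\<close>

definition parallelogram_defect :: "'a::complex_banach \<Rightarrow> 'a \<Rightarrow> real" where
  "parallelogram_defect x y = (norm (x + y))\<^sup>2 + (norm (x - y))\<^sup>2
     - (norm (x + \<i> *\<^sub>C y))\<^sup>2 - (norm (x - \<i> *\<^sub>C y))\<^sup>2"

lemma norm_add_i: "norm (y + \<i> *\<^sub>C x) = norm (x - \<i> *\<^sub>C (y::'a::complex_banach))"
  and norm_diff_i: "norm (y - \<i> *\<^sub>C x) = norm (x + \<i> *\<^sub>C y)"
proof -
  have "y + \<i> *\<^sub>C x = \<i> *\<^sub>C (x - \<i> *\<^sub>C y)" "y - \<i> *\<^sub>C x = (- \<i>) *\<^sub>C (x + \<i> *\<^sub>C y)"
    by (simp_all add: scaleC.diff_right scaleC_add_right scaleC_scaleC scaleC.minus_left)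
  then show "norm (y + \<i> *\<^sub>C x) = norm (x - \<i> *\<^sub>C y)" "norm (y - \<i> *\<^sub>C x) = norm (x + \<i> *\<^sub>C y)"
    by (simp_all add: norm_scaleC)
qed

lemma parallelogram_defect_commute: "parallelogram_defect y x = parallelogram_defect x y"
  unfolding parallelogram_defect_def norm_add_i[of y x] norm_diff_i[of y x]
  by (simp add: add.commute norm_minus_commute)

lemma polar_ip_commute: "polar_ip y x = cnj (polar_ip x y)"
  unfolding polar_ip_def norm_add_i[of y x] norm_diff_i[of y x] norm_minus_commute[of y x]
    add.commute[of y x]
  by (simp add: diff_divide_distrib add_divide_distrib right_diff_distrib)

lemma polar_ip_zero_left: "polar_ip 0 y = 0"
  by (simp add: polar_ip_def)

lemma norm_add_multiple: "norm (x + c *\<^sub>C x) = cmod (1 + c) * norm (x::'a::complex_banach)"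
  and norm_diff_multiple: "norm (x - c *\<^sub>C x) = cmod (1 - c) * norm x"
  by (simp_all add: norm_scaleC[symmetric] scaleC_add_left scaleC.diff_left)

lemma polar_ip_self: "polar_ip x x = of_real ((norm x)\<^sup>2)"
  using norm_add_multiple[of x 1] norm_add_multiple[of x \<i>] norm_diff_multiple[of x \<i>]
  by (simp add: polar_ip_def power_mult_distrib cmod_power2)

lemma parallelogram_defect_multiple: "parallelogram_defect x (c *\<^sub>C x) = 0"
proof -
  have "(cmod (1 + c))\<^sup>2 + (cmod (1 - c))\<^sup>2 - (cmod (1 + \<i> * c))\<^sup>2 - (cmod (1 - \<i> * c))\<^sup>2 = 0"
    unfolding cmod_power2 by (simp add: power2_eq_square algebra_simps)
  moreover have "parallelogram_defect x (c *\<^sub>C x)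
      = ((cmod (1 + c))\<^sup>2 + (cmod (1 - c))\<^sup>2 - (cmod (1 + \<i> * c))\<^sup>2 - (cmod (1 - \<i> * c))\<^sup>2) * (norm x)\<^sup>2"
    unfolding parallelogram_defect_def scaleC_scaleC norm_add_multiple norm_diff_multiple
    by (simp add: power_mult_distrib algebra_simps)
  ultimately show ?thesis by simp
qed

lemma parallelogram_defect_scale2:
  "parallelogram_defect ((2::complex) *\<^sub>C x) ((2::complex) *\<^sub>C y) = 4 * parallelogram_defect x y"
proof -
  have "\<i> *\<^sub>C (2::complex) *\<^sub>C y = (2::complex) *\<^sub>C \<i> *\<^sub>C y"
    by (simp add: scaleC_scaleC mult.commute)
  then show ?thesis
    by (simp add: parallelogram_defect_def scaleC_add_right[symmetric] scaleC.diff_right[symmetric]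
        norm_scaleC power_mult_distrib)
qed

locale rank_one_triple = jbstar_triple tp for tp :: "'a::complex_banach tprod" +
  assumes rank_one: "rank_one tp"
begin

lemmas cube = rank_one_cube[OF rank_one]

lemma tp_cube_expand:
  "tp (a + s *\<^sub>C b) (a + s *\<^sub>C b) (a + s *\<^sub>C b) = tp a a a + (2 * s) *\<^sub>C tp a a b + cnj s *\<^sub>C tp a b a
     + (s * s) *\<^sub>C tp b a b + (2 * s * cnj s) *\<^sub>C tp a b b + (s * s * cnj s) *\<^sub>C tp b b b"
proof -
  have two: "(2 * c) *\<^sub>C x = c *\<^sub>C x + c *\<^sub>C x" for c and x :: 'a
    unfolding scaleC_add_left[symmetric] by simp
  have "(2 * s * cnj s) *\<^sub>C tp a b b = (s * cnj s) *\<^sub>C tp a b b + (s * cnj s) *\<^sub>C tp a b b"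
    using two[of "s * cnj s"] by (simp add: mult.assoc)
  then show ?thesis
    using tp_sym[of b a a] tp_sym[of b b a] two[of s "tp a a b"]
    by (simp add: tp_add_left tp_add_mid tp_add_right tp_scaleC_left tp_scaleC_mid tp_scaleC_right
        scaleC_scaleC scaleC_add_right mult_ac add_ac)
qed

text \<open>Summing \<open>s {a + s b, a + s b, a + s b} = s \<bar>a + s b\<bar>\<^sup>2 (a + s b)\<close> over the fourth roots of
  unity \<open>s\<close> isolates the term \<open>{a, b, a}\<close>.\<close>

lemma tp_quadratic_defect:
  "(4::complex) *\<^sub>C tp a b a = (4 * polar_ip a b) *\<^sub>C a + of_real (parallelogram_defect a b) *\<^sub>C b"
proof -
  define f where "f s = s *\<^sub>C tp (a + s *\<^sub>C b) (a + s *\<^sub>C b) (a + s *\<^sub>C b)" for s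
  have four: "(4::complex) *\<^sub>C tp a b a = tp a b a + tp a b a + tp a b a + tp a b a"
  proof -
    have "(4::complex) = 1 + 1 + 1 + 1" by simp
    then show ?thesis by (simp only: scaleC_add_left scaleC_one)
  qed
  \<comment> \<open>The other terms of the cube carry \<open>s\<close>, \<open>s^2\<close> or
    \<open>s^3\<close> up to factors of modulus one squared, and these powers sum to 0 over the four
    roots.\<close>
  have sum_f: "f 1 + f (- 1) + f \<i> + f (- \<i>) = (4::complex) *\<^sub>C tp a b a"
    unfolding four f_def tp_cube_expand
    by (simp add: scaleC_add_right scaleC.diff_right scaleC_scaleC scaleC.minus_left algebra_simps)
  have ip4: "4 * polar_ip a b = of_real ((norm (a + b))\<^sup>2 - (norm (a - b))\<^sup>2)
      + \<i> * of_real ((norm (a + \<i> *\<^sub>C b))\<^sup>2 - (norm (a - \<i> *\<^sub>C b))\<^sup>2)"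
    by (simp add: polar_ip_def)
  \<comment> \<open>By the cube identity, \<open>a\<close> receives the sum of
    \<open>s * (norm (a + s *\<^sub>C b))\<^sup>2\<close> and \<open>b\<close> that of the same
    terms with \<open>s^2\<close>.\<close>
  have "f 1 + f (- 1) + f \<i> + f (- \<i>)
      = (4 * polar_ip a b) *\<^sub>C a + of_real (parallelogram_defect a b) *\<^sub>C b"
    unfolding f_def cube ip4
    by (simp add: parallelogram_defect_def scaleC_add_right scaleC_scaleC
        scaleC.minus_left scaleC.minus_right scaleC_add_left scaleC.diff_left scaleC.diff_right algebra_simps)
  with sum_f show ?thesis by simp
qed

text \<open>\<open>{a, b, a}\<close> is real-homogeneous in \<open>b\<close>. Doubling
  \<open>b\<close> and comparing coefficients in \<open>tp_quadratic_defect\<close> would otherwise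
  exhibit \<open>b\<close> as a multiple of \<open>a\<close>.\<close>

lemma parallelogram_defect_scale_right:
  fixes a b :: 'a
  assumes "\<nexists>c. b = c *\<^sub>C a"
  shows "parallelogram_defect a ((2::complex) *\<^sub>C b) = parallelogram_defect a b"
proof (rule ccontr)
  let ?D = "parallelogram_defect a b" and ?D' = "parallelogram_defect a ((2::complex) *\<^sub>C b)"
  assume "?D' \<noteq> ?D"
  then have nz: "of_real (2 * (?D' - ?D)) \<noteq> (0 :: complex)" unfolding of_real_eq_0_iff by simp
  let ?k = "2 * (4 * polar_ip a b) - 4 * polar_ip a ((2::complex) *\<^sub>C b)"
  have "(2::complex) *\<^sub>C (4::complex) *\<^sub>C tp a b a = (4::complex) *\<^sub>C tp a ((2::complex) *\<^sub>C b) a"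
    by (simp add: tp_scaleC_mid scaleC_scaleC mult.commute)
  then have "of_real (2 * (?D' - ?D)) *\<^sub>C b = ?k *\<^sub>C a"
    unfolding tp_quadratic_defect
    by (simp add: scaleC_add_right scaleC_scaleC scaleC.diff_left algebra_simps)
  then have "(1 / of_real (2 * (?D' - ?D))) *\<^sub>C of_real (2 * (?D' - ?D)) *\<^sub>C b
      = (1 / of_real (2 * (?D' - ?D))) *\<^sub>C ?k *\<^sub>C a"
    by simp
  then have "b = ((1 / of_real (2 * (?D' - ?D))) * ?k) *\<^sub>C a"
    using nz unfolding scaleC_scaleC by simp
  then show False using assms by blast
qed

text \<open>On independent vectors the defect is invariant under doubling either argument, but also
  homogeneous of degree two.\<close>

lemma parallelogram_defect_zero: "parallelogram_defect (a :: 'a) b = 0"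
proof (cases "\<exists>c. b = c *\<^sub>C a")
  case True
  then show ?thesis using parallelogram_defect_multiple by blast
next
  case False
  show ?thesis
  proof (cases "\<exists>c. a = c *\<^sub>C b")
    case True
    then show ?thesis using parallelogram_defect_multiple parallelogram_defect_commute by metis
  next
    case indep: False
    have "\<nexists>c. b = c *\<^sub>C ((2::complex) *\<^sub>C a)"
      using False by (auto simp: scaleC_scaleC)
    then have "4 * parallelogram_defect a b = parallelogram_defect ((2::complex) *\<^sub>C a) b"
      unfolding parallelogram_defect_scale2[symmetric] by (rule parallelogram_defect_scale_right)
    also have "\<dots> = parallelogram_defect a b"
      using parallelogram_defect_scale_right[OF indep] parallelogram_defect_commute by metis
    finally show ?thesis by simp
  qed
qed

lemma tp_quadratic: "tp a b a = polar_ip a b *\<^sub>C a"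
proof -
  have "(4::complex) *\<^sub>C tp a b a = (4::complex) *\<^sub>C polar_ip a b *\<^sub>C a"
    using tp_quadratic_defect[of a b] by (simp add: parallelogram_defect_zero scaleC_scaleC)
  then have "(4::complex) *\<^sub>C (tp a b a - polar_ip a b *\<^sub>C a) = 0"
    unfolding scaleC.diff_right by simp
  then show ?thesis by simp
qed

text \<open>With the defect gone, \<open>polar_ip a b\<close> is the coefficient of \<open>a\<close>
  in \<open>{a, b, a}\<close>, so additivity is inherited from the middle variable of the triple
  product.\<close>

lemma polar_ip_add_right: "polar_ip (a :: 'a) (b + c) = polar_ip a b + polar_ip a c"
proof (cases "a = 0")
  case False
  have "polar_ip a (b + c) *\<^sub>C a = (polar_ip a b + polar_ip a c) *\<^sub>C a"
    by (simp add: tp_quadratic[symmetric] tp_add_mid scaleC_add_left)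
  then show ?thesis using False by (simp add: scaleC_right_cancel)
qed (simp add: polar_ip_zero_left)

lemma polar_ip_scaleC_right: "polar_ip (a :: 'a) (c *\<^sub>C b) = cnj c * polar_ip a b"
proof (cases "a = 0")
  case False
  have "polar_ip a (c *\<^sub>C b) *\<^sub>C a = (cnj c * polar_ip a b) *\<^sub>C a"
    by (simp add: tp_quadratic[symmetric] tp_scaleC_mid scaleC_scaleC[symmetric])
  then show ?thesis using False by (simp add: scaleC_right_cancel)
qed (simp add: polar_ip_zero_left)

sublocale complex_inner_product "polar_ip :: 'a \<Rightarrow> 'a \<Rightarrow> complex"
proof
  fix x y z :: 'a and c
  show "polar_ip (x + y) z = polar_ip x z + polar_ip y z"
    using polar_ip_add_right[of z x y] polar_ip_commute[of z] by (metis complex_cnj_add complex_cnj_cnj)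
  show "polar_ip (c *\<^sub>C x) z = c * polar_ip x z"
    using polar_ip_scaleC_right[of z c x] polar_ip_commute[of z] by (metis complex_cnj_mult complex_cnj_cnj)
  show "polar_ip y x = cnj (polar_ip x y)" by (rule polar_ip_commute)
  show "polar_ip x x = of_real ((norm x)\<^sup>2)" by (rule polar_ip_self)
qed

text \<open>Polarization of \<open>tp_quadratic\<close> in the outer variable.\<close>

theorem tp_formula: "tp x y z = (1 / 2) *\<^sub>C (polar_ip x y *\<^sub>C z + polar_ip z y *\<^sub>C x)"
proof -
  have "tp (x + z) y (x + z) = tp x y x + (tp x y z + tp x y z) + tp z y z"
    using tp_sym[of z y x] by (simp add: tp_add_left tp_add_right add_ac)
  moreover have "tp (x + z) y (x + z)
      = tp x y x + (polar_ip x y *\<^sub>C z + polar_ip z y *\<^sub>C x) + tp z y z"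
    by (simp add: tp_quadratic ip_add_left scaleC_add_left scaleC_add_right add_ac)
  ultimately have "polar_ip x y *\<^sub>C z + polar_ip z y *\<^sub>C x = tp x y z + tp x y z" by simp
  also have "\<dots> = (2::complex) *\<^sub>C tp x y z"
    using scaleC_add_left[of 1 1 "tp x y z"] by simp
  finally show ?thesis by (simp add: scaleC_scaleC)
qed

section \<open>Minimal tripotents and transition pseudo-probabilities\<close>

text \<open>All Peirce spaces of a unit vector can be read off here: eigenvalue 1 on the line of
  \<open>e\<close>, 1/2 on its orthogonal complement, and nothing for 0.\<close>

lemma L_op_unit:
  assumes "norm e = 1"
  shows "L_op tp e e x = (1 / 2) *\<^sub>C (x + polar_ip x e *\<^sub>C e)"
  using assms by (simp add: L_op_def tp_formula ip_self)

lemma peirce_space_2: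
  assumes "norm e = 1"
  shows "peirce_space tp 2 e = range (\<lambda>z. z *\<^sub>C e)"
proof (intro equalityI subsetI)
  fix x assume "x \<in> peirce_space tp 2 e"
  then have "x = (1 / 2) *\<^sub>C (x + polar_ip x e *\<^sub>C e)"
    by (simp add: peirce_space_def L_op_unit[OF assms])
  then have "(2::complex) *\<^sub>C x = (2::complex) *\<^sub>C (1 / 2) *\<^sub>C (x + polar_ip x e *\<^sub>C e)" by simp
  moreover have "(2::complex) *\<^sub>C x = x + x" using scaleC_add_left[of 1 1 x] by simp
  ultimately have "x = polar_ip x e *\<^sub>C e" by (simp add: scaleC_scaleC)
  then show "x \<in> range (\<lambda>z. z *\<^sub>C e)" by blast
next
  fix x assume "x \<in> range (\<lambda>z. z *\<^sub>C e)"
  then obtain z where "x = z *\<^sub>C e" by blast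
  then show "x \<in> peirce_space tp 2 e"
    using assms
    by (simp add: peirce_space_def L_op_unit ip_scaleC_left ip_self scaleC_add_left[symmetric] scaleC_scaleC)
qed

lemma peirce_space_1:
  assumes "norm e = 1"
  shows "x \<in> peirce_space tp 1 e \<longleftrightarrow> polar_ip x e = 0"
  using assms by (auto simp: peirce_space_def L_op_unit scaleC_add_right)

lemma peirce_space_0:
  assumes "norm e = 1" "x \<in> peirce_space tp 0 e"
  shows "x = 0"
proof -
  have x: "x + polar_ip x e *\<^sub>C e = 0"
    using assms by (simp add: peirce_space_def L_op_unit)
  then have "polar_ip (x + polar_ip x e *\<^sub>C e) e = 0" by simp
  then have "polar_ip x e = 0" using assms(1) by (simp add: ip_add_left ip_scaleC_left ip_self)
  then show ?thesis using x by simp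
qed

lemma peirce_proj_2:
  assumes e: "norm e = 1"
  shows "peirce_proj tp 2 e x = polar_ip x e *\<^sub>C e"
  unfolding peirce_proj_def
proof (rule the_equality)
  have idx: "{0..2} - {2::nat} = {0, 1}" by auto
  let ?f = "\<lambda>j::nat. if j = 1 then x - polar_ip x e *\<^sub>C e else 0"
  have "?f 1 \<in> peirce_space tp 1 e"
    using e by (simp add: peirce_space_1[simplified] ip_diff_left ip_scaleC_left ip_self)
  moreover have "?f 0 \<in> peirce_space tp 0 e"
    using e by (simp add: peirce_space_def L_op_unit)
  ultimately show "polar_ip x e *\<^sub>C e \<in> peirce_space tp 2 e \<and>
      (\<exists>f. (\<forall>j\<in>{0..2} - {2}. f j \<in> peirce_space tp j e) \<and>
        x = polar_ip x e *\<^sub>C e + (\<Sum>j\<in>{0..2} - {2}. f j))"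
    unfolding idx by (intro conjI exI[of _ ?f]) (auto simp: peirce_space_2[OF e])
  fix y assume "y \<in> peirce_space tp 2 e \<and>
      (\<exists>f. (\<forall>j\<in>{0..2} - {2}. f j \<in> peirce_space tp j e) \<and> x = y + (\<Sum>j\<in>{0..2} - {2}. f j))"
  then obtain f :: "nat \<Rightarrow> 'a" where y: "y \<in> peirce_space tp 2 e" and f: "f 0 \<in> peirce_space tp 0 e"
    "f 1 \<in> peirce_space tp 1 e" and x: "x = y + (f 0 + f 1)"
    unfolding idx by auto
  obtain z where z: "y = z *\<^sub>C e" using y peirce_space_2[OF e] by auto
  \<comment> \<open>Pairing with \<open>e\<close> removes the two lower Peirce components and leaves
    the coefficient of \<open>e\<close>.\<close>
  have "polar_ip x e = z"
    using x f peirce_space_0[OF e f(1)] peirce_space_1[OF e, of "f 1"] e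
    by (simp add: z ip_add_left ip_scaleC_left ip_self)
  then show "y = polar_ip x e *\<^sub>C e" using z by simp
qed

text \<open>A nonzero tripotent has \<open>norm e ^ 3 = norm e\<close>; conversely the cube identity
  fixes unit vectors, whose Peirce 2-space is a line.\<close>

lemma minimal_tripotents_iff: "e \<in> minimal_tripotents tp \<longleftrightarrow> norm e = 1"
proof
  assume "e \<in> minimal_tripotents tp"
  then have "e \<noteq> 0" and "tp e e e = e"
    by (auto simp: minimal_tripotents_def tripotent_def)
  then have "norm e * (norm e * norm e) = norm e"
    using norm_tp_cube[of e] by (simp add: power3_eq_cube)
  then have "(norm e)\<^sup>2 = 1" using \<open>e \<noteq> 0\<close> by (simp add: power2_eq_square)
  then show "norm e = 1" by (simp add: power2_eq_1_iff) (metis norm_ge_zero not_one_le_zero neg_0_le_iff_le)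
next
  assume e: "norm e = 1"
  then have "e \<noteq> 0" by auto
  moreover have "1 *\<^sub>C e \<in> range (\<lambda>z. z *\<^sub>C e)" by blast
  ultimately have "range (\<lambda>z. z *\<^sub>C e) \<noteq> {0}" by auto
  then show "e \<in> minimal_tripotents tp"
    using cube[of e] by (simp add: minimal_tripotents_def tripotent_def e peirce_space_2)
qed

text \<open>The candidate is extreme by rotundity of the Hilbert ball; any competitor agrees with it
  by comparing coefficients of \<open>e\<close> in the Peirce 2-projection.\<close>

lemma phi_eq_functional:
  assumes e: "norm e = 1"
  shows "phi tp e = functional e"
  unfolding phi_def predual_eq_cdual
proof (rule the_equality)
  show "functional e extreme_point_of {f \<in> cdual. norm f \<le> 1} \<and>
      (\<forall>x. peirce_proj tp 2 e x = blinfun_apply (functional e) x *\<^sub>C e)"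
    by (simp add: functional_extreme_point[OF e] peirce_proj_2[OF e])
  fix \<phi> :: "'a \<Rightarrow>\<^sub>L complex"
  assume "\<phi> extreme_point_of {f \<in> cdual. norm f \<le> 1} \<and>
      (\<forall>x. peirce_proj tp 2 e x = blinfun_apply \<phi> x *\<^sub>C e)"
  then have "polar_ip x e *\<^sub>C e = blinfun_apply \<phi> x *\<^sub>C e" for x
    by (simp add: peirce_proj_2[OF e])
  moreover have "e \<noteq> 0" using e by auto
  ultimately show "\<phi> = functional e"
    by (intro blinfun_eqI) (simp add: scaleC_right_cancel)
qed

lemma TTP_eq_ip:
  assumes "norm v = 1"
  shows "TTP tp e v = polar_ip e v"
  by (simp add: TTP_def phi_eq_functional[OF assms])

end

section \<open>Extension of maps preserving the inner product of unit vectors\<close>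

lemma isometric_extension:
  fixes ipE :: "'e::complex_banach \<Rightarrow> 'e \<Rightarrow> complex" and ipF :: "'f::complex_banach \<Rightarrow> 'f \<Rightarrow> complex"
  assumes "complex_inner_product ipE" "complex_inner_product ipF"
    and norm: "\<And>e. norm e = 1 \<Longrightarrow> norm (\<Phi> e) = 1"
    and ip: "\<And>u e. norm u = 1 \<Longrightarrow> norm e = 1 \<Longrightarrow> ipF (\<Phi> u) (\<Phi> e) = ipE u e"
  obtains T where "clinear T" "\<And>x y. ipF (T x) (T y) = ipE x y" "\<And>e. norm e = 1 \<Longrightarrow> T e = \<Phi> e"
proof -
  interpret E: complex_inner_product ipE by fact
  interpret F: complex_inner_product ipF by fact
  \<comment> \<open>The positively homogeneous extension of \<open>\<Phi>\<close> from the unit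
    sphere. At \<open>x = 0\<close> the outer factor is 0, so \<open>T 0 = 0\<close> whatever the
    value of \<open>\<Phi> 0\<close>.\<close>
  define T where "T x = complex_of_real (norm x) *\<^sub>C \<Phi> (complex_of_real (inverse (norm x)) *\<^sub>C x)" for x
  have unit: "norm (complex_of_real (inverse (norm x)) *\<^sub>C x) = 1" if "x \<noteq> 0" for x :: 'e
    using that by (simp add: norm_scaleC norm_inverse)
  have ipT: "ipF (T x) (T y) = ipE x y" for x y
  proof (cases "x = 0 \<or> y = 0")
    case False
    then have nz: "x \<noteq> 0" "y \<noteq> 0" by auto
    show ?thesis
      unfolding T_def F.ip_scaleC_left F.ip_scaleC_right ip[OF unit[OF nz(1)] unit[OF nz(2)]]
        E.ip_scaleC_left E.ip_scaleC_right
      using nz by (simp add: field_simps)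
  qed (auto simp: T_def)
  have zero: "x = 0" if "ipF x x = 0" for x
    using that by (simp add: F.ip_self)
  have "clinear T"
    unfolding clinear_def
  proof (intro conjI allI)
    fix x y c
    \<comment> \<open>The defect of additivity has norm 0: its square expands into inner products of
      values of \<open>T\<close>, each of which can be computed in the domain, where they sum to 0.
      Homogeneity is shown in the same way.\<close>
    have "ipF (T (x + y) - T x - T y) (T (x + y) - T x - T y) = ipE (x + y - x - y) (x + y - x - y)"
      unfolding F.ip_diff_left F.ip_diff_right E.ip_diff_left E.ip_diff_right ipT ..
    then have "T (x + y) - T x - T y = 0" by (intro zero) simp
    then show "T (x + y) = T x + T y" by (simp add: algebra_simps)
    have "ipF (T (c *\<^sub>C x) - c *\<^sub>C T x) (T (c *\<^sub>C x) - c *\<^sub>C T x)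
        = ipE (c *\<^sub>C x - c *\<^sub>C x) (c *\<^sub>C x - c *\<^sub>C x)"
      unfolding F.ip_diff_left F.ip_diff_right E.ip_diff_left E.ip_diff_right
        F.ip_scaleC_left F.ip_scaleC_right ipT E.ip_scaleC_left E.ip_scaleC_right
      by (simp add: algebra_simps)
    then have "T (c *\<^sub>C x) - c *\<^sub>C T x = 0" by (intro zero) simp
    then show "T (c *\<^sub>C x) = c *\<^sub>C T x" by simp
  qed
  moreover have "T e = \<Phi> e" if "norm e = 1" for e
    using that by (simp add: T_def)
  ultimately show thesis using that ipT by blast
qed

theorem proposition2p2:
  fixes tpE :: "'e::complex_banach \<Rightarrow> 'e \<Rightarrow> 'e \<Rightarrow> 'e"
    and tpF :: "'f::complex_banach \<Rightarrow> 'f \<Rightarrow> 'f \<Rightarrow> 'f"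
    and \<Phi> :: "'e \<Rightarrow> 'f"
  assumes "jbstar_triple tpE" and "rank_one tpE"
    and "jbstar_triple tpF" and "rank_one tpF"
    and "\<And>e. e \<in> minimal_tripotents tpE \<Longrightarrow> \<Phi> e \<in> minimal_tripotents tpF"
    and "\<And>u e. u \<in> minimal_tripotents tpE \<Longrightarrow> e \<in> minimal_tripotents tpE
           \<Longrightarrow> TTP tpF (\<Phi> u) (\<Phi> e) = TTP tpE u e"
  shows "\<exists>T :: 'e \<Rightarrow> 'f. clinear T \<and> (\<forall>x. norm (T x) = norm x) \<and> triple_homomorphism tpE tpF T \<and>
           (\<forall>e\<in>minimal_tripotents tpE. T e = \<Phi> e)"
proof -
  interpret E: rank_one_triple tpE
    using assms(1,2) by (simp add: rank_one_triple_def rank_one_triple_axioms_def)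
  interpret F: rank_one_triple tpF
    using assms(3,4) by (simp add: rank_one_triple_def rank_one_triple_axioms_def)
  \<comment> \<open>In both triples the minimal tripotents are exactly the unit vectors, so
    \<open>\<Phi>\<close> maps sphere to sphere.\<close>
  have norm: "norm (\<Phi> e) = 1" if "norm e = 1" for e
    using assms(5)[of e] that by (simp add: E.minimal_tripotents_iff F.minimal_tripotents_iff)
  have ip: "polar_ip (\<Phi> u) (\<Phi> e) = polar_ip u e" if "norm u = 1" "norm e = 1" for u e
    using assms(6)[of u e] that norm
    by (simp add: E.minimal_tripotents_iff E.TTP_eq_ip F.TTP_eq_ip)
  obtain T where T: "clinear T" "\<And>x y. polar_ip (T x) (T y) = polar_ip x y"
    "\<And>e. norm e = 1 \<Longrightarrow> T e = \<Phi> e"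
    using isometric_extension[OF E.complex_inner_product_axioms F.complex_inner_product_axioms, of \<Phi>]
      norm ip by blast
  have "(norm (T x))\<^sup>2 = (norm x)\<^sup>2" for x
    using T(2)[of x x] unfolding polar_ip_self of_real_eq_iff .
  then have "norm (T x) = norm x" for x by simp
  \<comment> \<open>The triple product is expressed through the inner product and scalar multiples,
    both of which \<open>T\<close> respects.\<close>
  moreover have "triple_homomorphism tpE tpF T"
    using T(1) unfolding triple_homomorphism_def E.tp_formula F.tp_formula
    by (simp add: clinear_add clinear_scaleC T(2))
  ultimately show ?thesis
    using T by (intro exI[of _ T]) (simp add: E.minimal_tripotents_iff)
qed

end
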